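(* Let $\sigma_0>0$ and $\alpha_0\in\mathbb{R}$ with $\alpha_0\neq 0$, and let $e_3=(0,0,1)$. Let $\Omega_0\subset\mathbb{R}^3$ be a bounded strictly convex open set with $C^5$ boundary. Let $u_0\in H^5(\Omega_0,\mathbb{R}^3)$ be a vector field with $\operatorname{curl}u_0=\alpha_0 e_3$ in $\Omega_0$ and $\int_{\Omega_0}u_0\,dx=0$. Let $(u,\Omega_t)$ be a classical solution, in a time interval $(-\delta,\delta)$ with $\delta>0$, of the Cauchy problem for the free boundary system $$\begin{cases}\partial_t u+\langle u,\nabla\rangle u+\nabla p=0&\text{in }\Omega_t,\\ \operatorname{div}u=0&\text{in }\Omega_t,\\ p=\sigma_0H_{\partial\Omega_t}&\text{on }\partial\Omega_t,\\ V_t=\langle u,\nu_{\partial\Omega_t}\rangle&\text{on }\partial\Omega_t,\end{cases}$$ with initial datum $(u_0,\Omega_0)$ at time $t=0$. If $\operatorname{curl}u=\alpha_0e_3$ in $\Omega_t$ for all $t\in(-\delta,\delta)$, then there exists $\lambda_0\in\mathbb{R}$ such that: - $\Omega_0$ is symmetric with respect to the plane $\{x_3=\lambda_0\}$; - the surface $\partial\Omega_0\cap\{x_3>\lambda_0\}$ is a graph over the plane domain $\Omega_0\cap\{x_3=\lambda_0\}$; - the vector field $u_0$ is independent of the variable $x_3$, and its third component is $u_{0,3}=0$.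
   Context: The unknowns are the bounded open sets $\Omega_t\subset\mathbb{R}^3$ (the fluid domain), the velocity field $u(t,\cdot):\Omega_t\to\mathbb{R}^3$ and the pressure $p(t,\cdot):\Omega_t\to\mathbb{R}$ (continuous up to the boundary, so that the boundary condition makes sense). $\langle u,\nabla\rangle u=\sum_j u_j\partial_{x_j}u$. $\nu_{\partial\Omega_t}$ is the outer unit normal, $V_t$ is the normal velocity of the moving boundary $\partial\Omega_t$ in the direction $\nu_{\partial\Omega_t}$, and $H_{\partial\Omega_t}=\operatorname{div}_{\partial\Omega_t}\nu_{\partial\Omega_t}$ (tangential divergence of the outer unit normal) is the mean curvature, i.e. the sum of the principal curvatures, positive for convex sets and equal to $2$ on the unit sphere of $\mathbb{R}^3$. A classical solution is one regular enough in space and time that all equations hold pointwise and that the vorticity $w=\operatorname{curl}u$ satisfies $\partial_tw+\langle u,\nabla\rangle w=\langle w,\nabla\rangle u$. *)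

theory Defs
  imports "HOL-Analysis.Analysis"
begin

section \<open>Functions of class \<open>C\<^sup>k\<close> and differential operators\<close>

text \<open>The set \<open>U\<close> is meant to be open. The derivatives are jointly continuous on \<open>U\<close> because
  all directional derivatives are required to be of class \<open>C\<^sup>k\<close> again.\<close>

primrec Ck_on :: "nat \<Rightarrow> ('a::euclidean_space \<Rightarrow> 'b::real_normed_vector) \<Rightarrow> 'a set \<Rightarrow> bool" where
  "Ck_on 0 f U \<longleftrightarrow> continuous_on U f"
| "Ck_on (Suc k) f U \<longleftrightarrow>
     (\<forall>x\<in>U. f differentiable (at x)) \<and> (\<forall>v. Ck_on k (\<lambda>x. frechet_derivative f (at x) v) U)"

primrec iterated_derivative ::
  "'a list \<Rightarrow> ('a::euclidean_space \<Rightarrow> 'b::real_normed_vector) \<Rightarrow> 'a \<Rightarrow> 'b" where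
  "iterated_derivative [] f = f"
| "iterated_derivative (b # bs) f = (\<lambda>x. frechet_derivative (iterated_derivative bs f) (at x) b)"

definition grad :: "('a::euclidean_space \<Rightarrow> real) \<Rightarrow> 'a \<Rightarrow> 'a" where
  "grad f x = (\<Sum>b\<in>Basis. frechet_derivative f (at x) b *\<^sub>R b)"

definition partial_deriv :: "'n \<Rightarrow> (real^'n::finite \<Rightarrow> 'b::real_normed_vector) \<Rightarrow> real^'n \<Rightarrow> 'b" where
  "partial_deriv i f x = frechet_derivative f (at x) (axis i 1)"

definition divergence :: "(real^3 \<Rightarrow> real^3) \<Rightarrow> real^3 \<Rightarrow> real" where
  "divergence u x = (\<Sum>i\<in>UNIV. partial_deriv i u x $ i)"

definition curl :: "(real^3 \<Rightarrow> real^3) \<Rightarrow> real^3 \<Rightarrow> real^3" where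
  "curl u x = vector
     [partial_deriv 2 u x $ 3 - partial_deriv 3 u x $ 2,
      partial_deriv 3 u x $ 1 - partial_deriv 1 u x $ 3,
      partial_deriv 1 u x $ 2 - partial_deriv 2 u x $ 1]"

text \<open>\<open>advect v u\<close> is \<open>\<langle>v, \<nabla>\<rangle> u\<close>.\<close>

definition advect :: "(real^3 \<Rightarrow> real^3) \<Rightarrow> (real^3 \<Rightarrow> real^3) \<Rightarrow> real^3 \<Rightarrow> real^3" where
  "advect v u x = (\<Sum>j\<in>UNIV. v x $ j *\<^sub>R partial_deriv j u x)"


section \<open>The Sobolev spaces \<open>H\<^sup>k\<close>\<close>

definition test_function :: "'a::euclidean_space set \<Rightarrow> ('a \<Rightarrow> real) \<Rightarrow> bool" where
  "test_function S \<phi> \<longleftrightarrow> (\<forall>k. Ck_on k \<phi> UNIV) \<and>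
     compact (closure {x. \<phi> x \<noteq> 0}) \<and> closure {x. \<phi> x \<noteq> 0} \<subseteq> S"

definition square_integrable_on ::
  "('a::euclidean_space \<Rightarrow> 'b::euclidean_space) \<Rightarrow> 'a set \<Rightarrow> bool" where
  "square_integrable_on f S \<longleftrightarrow> f \<in> borel_measurable (lebesgue_on S) \<and>
     integrable (lebesgue_on S) (\<lambda>x. (norm (f x))\<^sup>2)"

text \<open>A list \<open>bs\<close> of basis vectors stands for a multi-index of order \<open>length bs\<close>.\<close>

definition weak_derivative_on ::
  "'a list \<Rightarrow> ('a::euclidean_space \<Rightarrow> 'b::euclidean_space) \<Rightarrow> ('a \<Rightarrow> 'b) \<Rightarrow> 'a set \<Rightarrow> bool" where
  "weak_derivative_on bs f g S \<longleftrightarrow> (\<forall>\<phi>. test_function S \<phi> \<longrightarrow>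
     (LINT x|lebesgue_on S. iterated_derivative bs \<phi> x *\<^sub>R f x) =
     (- 1) ^ length bs *\<^sub>R (LINT x|lebesgue_on S. \<phi> x *\<^sub>R g x))"

definition sobolev_H ::
  "nat \<Rightarrow> 'a set \<Rightarrow> ('a::euclidean_space \<Rightarrow> 'b::euclidean_space) set" where
  "sobolev_H k S = {f. square_integrable_on f S \<and>
     (\<forall>bs. set bs \<subseteq> Basis \<and> length bs \<le> k \<longrightarrow>
        (\<exists>g. square_integrable_on g S \<and> weak_derivative_on bs f g S))}"


section \<open>Domains, their boundaries and their curvature\<close>

definition strictly_convex :: "'a::euclidean_space set \<Rightarrow> bool" where
  "strictly_convex S \<longleftrightarrow>
     (\<forall>x\<in>closure S. \<forall>y\<in>closure S. x \<noteq> y \<longrightarrow> open_segment x y \<subseteq> interior S)"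

text \<open>A local \<open>C\<^sup>k\<close> defining function. As its gradient does not vanish,
  \<open>frontier \<Omega> \<inter> U\<close> is automatically its zero set.\<close>

definition defining_function ::
  "nat \<Rightarrow> 'a::euclidean_space set \<Rightarrow> 'a set \<Rightarrow> ('a \<Rightarrow> real) \<Rightarrow> bool" where
  "defining_function k \<Omega> U \<phi> \<longleftrightarrow> open U \<and> Ck_on k \<phi> U \<and>
     (\<forall>x\<in>U. grad \<phi> x \<noteq> 0 \<and> (x \<in> \<Omega> \<longleftrightarrow> \<phi> x < 0))"

definition Ck_boundary :: "nat \<Rightarrow> 'a::euclidean_space set \<Rightarrow> bool" where
  "Ck_boundary k \<Omega> \<longleftrightarrow> (\<forall>x\<in>frontier \<Omega>. \<exists>U \<phi>. x \<in> U \<and> defining_function k \<Omega> U \<phi>)"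

text \<open>At a point of a \<open>C\<^sup>1\<close> boundary the normalized gradient is the same for all local defining
  functions; elsewhere the value is irrelevant.\<close>

definition outer_normal :: "'a::euclidean_space set \<Rightarrow> 'a \<Rightarrow> 'a" where
  "outer_normal \<Omega> x = (THE n. \<exists>U \<phi>. x \<in> U \<and> defining_function 1 \<Omega> U \<phi> \<and>
     n = grad \<phi> x /\<^sub>R norm (grad \<phi> x))"

text \<open>Tangential divergence at \<open>x\<close>, along a surface \<open>\<Gamma>\<close> with unit normal \<open>n\<close> at \<open>x\<close>, of a field
  \<open>X\<close> given on \<open>\<Gamma>\<close>. A derivative \<open>X'\<close> within \<open>\<Gamma>\<close> is determined only on the tangent space;
  the normal part of its trace is subtracted, so what is left is
  \<open>\<Sum>\<^sub>i \<langle>X' \<tau>\<^sub>i, \<tau>\<^sub>i\<rangle>\<close> over an orthonormal basis \<open>\<tau>\<^sub>i\<close> of the tangent space.\<close>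

definition tangential_divergence ::
  "'a::euclidean_space set \<Rightarrow> 'a \<Rightarrow> ('a \<Rightarrow> 'a) \<Rightarrow> 'a \<Rightarrow> real" where
  "tangential_divergence \<Gamma> n X x = (THE d. \<exists>X'. (X has_derivative X') (at x within \<Gamma>) \<and>
     d = (\<Sum>b\<in>Basis. X' b \<bullet> b) - X' n \<bullet> n)"

definition mean_curvature :: "'a::euclidean_space set \<Rightarrow> 'a \<Rightarrow> real" where
  "mean_curvature \<Omega> x =
     tangential_divergence (frontier \<Omega>) (outer_normal \<Omega> x) (outer_normal \<Omega>) x"


section \<open>Moving domains\<close>

definition space_time :: "real \<Rightarrow> (real \<Rightarrow> 'a set) \<Rightarrow> (real \<times> 'a) set" where
  "space_time \<delta> \<Omega> = {(t, x). t \<in> {-\<delta><..<\<delta>} \<and> x \<in> \<Omega> t}"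

definition moving_defining_function ::
  "(real \<Rightarrow> 'a::euclidean_space set) \<Rightarrow> (real \<times> 'a) set \<Rightarrow> (real \<times> 'a \<Rightarrow> real) \<Rightarrow> bool" where
  "moving_defining_function \<Omega> U \<phi> \<longleftrightarrow> open U \<and> Ck_on 1 \<phi> U \<and>
     (\<forall>(t, x)\<in>U. grad (\<lambda>y. \<phi> (t, y)) x \<noteq> 0 \<and> (x \<in> \<Omega> t \<longleftrightarrow> \<phi> (t, x) < 0))"

text \<open>The lateral boundary of the space-time domain is a \<open>C\<^sup>1\<close> hypersurface which is nowhere
  tangent to a time slice. In particular its slice at time \<open>t\<close> is \<open>frontier (\<Omega> t)\<close>.\<close>

definition moving_domain :: "real \<Rightarrow> (real \<Rightarrow> 'a::euclidean_space set) \<Rightarrow> bool" where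
  "moving_domain \<delta> \<Omega> \<longleftrightarrow> open (space_time \<delta> \<Omega>) \<and>
     (\<forall>(t, x)\<in>frontier (space_time \<delta> \<Omega>). t \<in> {-\<delta><..<\<delta>} \<longrightarrow>
        (\<exists>U \<phi>. (t, x) \<in> U \<and> moving_defining_function \<Omega> U \<phi>))"

text \<open>If \<open>x(t)\<close> moves with the boundary, then \<open>\<phi> (t, x(t)) = 0\<close> gives
  \<open>\<partial>\<^sub>t\<phi> + \<langle>x', \<nabla>\<phi>\<rangle> = 0\<close>, and the velocity of the boundary in the direction
  \<open>\<nabla>\<phi> / |\<nabla>\<phi>|\<close> of the outer normal is \<open>-\<partial>\<^sub>t\<phi> / |\<nabla>\<phi>|\<close>.\<close>

definition normal_velocity :: "(real \<Rightarrow> 'a::euclidean_space set) \<Rightarrow> real \<Rightarrow> 'a \<Rightarrow> real" where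
  "normal_velocity \<Omega> t x = (THE V. \<exists>U \<phi>. (t, x) \<in> U \<and> moving_defining_function \<Omega> U \<phi> \<and>
     V = - deriv (\<lambda>s. \<phi> (s, x)) t / norm (grad (\<lambda>y. \<phi> (t, y)) x))"


section \<open>The free boundary problem\<close>

text \<open>Only the values of \<open>u t\<close> and \<open>p t\<close> on \<open>closure (\<Omega> t)\<close> for \<open>-\<delta> < t < \<delta>\<close> matter; their
  boundary values are the continuous extensions of the interior ones. The regularity required is
  what it takes to write down all the equations pointwise. With so little of it the vorticity
  equation does not follow from the momentum equation, so it is part of the definition.\<close>

definition classical_solution ::
  "real \<Rightarrow> real \<Rightarrow> (real \<Rightarrow> (real^3) set) \<Rightarrow> (real \<Rightarrow> real^3 \<Rightarrow> real^3) \<Rightarrow>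
     (real \<Rightarrow> real^3 \<Rightarrow> real) \<Rightarrow> bool" where
  "classical_solution \<sigma> \<delta> \<Omega> u p \<longleftrightarrow>
     \<comment> \<open>regularity\<close>
     moving_domain \<delta> \<Omega> \<and>
     (\<lambda>(t, x). u t x) differentiable_on space_time \<delta> \<Omega> \<and>
     (\<lambda>(t, x). curl (u t) x) differentiable_on space_time \<delta> \<Omega> \<and>
     (\<forall>t\<in>{-\<delta><..<\<delta>}.
        open (\<Omega> t) \<and> bounded (\<Omega> t) \<and> Ck_boundary 2 (\<Omega> t) \<and>
        continuous_on (closure (\<Omega> t)) (u t) \<and>
        continuous_on (closure (\<Omega> t)) (p t) \<and> p t differentiable_on \<Omega> t) \<and>
     \<comment> \<open>equations\<close>
     (\<forall>t\<in>{-\<delta><..<\<delta>}.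
        (\<forall>x\<in>\<Omega> t.
           vector_derivative (\<lambda>s. u s x) (at t) + advect (u t) (u t) x + grad (p t) x = 0 \<and>
           divergence (u t) x = 0 \<and>
           vector_derivative (\<lambda>s. curl (u s) x) (at t) + advect (u t) (curl (u t)) x
             = advect (curl (u t)) (u t) x) \<and>
        (\<forall>x\<in>frontier (\<Omega> t).
           p t x = \<sigma> * mean_curvature (\<Omega> t) x \<and>
           normal_velocity \<Omega> t x = u t x \<bullet> outer_normal (\<Omega> t) x))"


section \<open>Reflections and graphs\<close>

definition reflect3 :: "real \<Rightarrow> real^3 \<Rightarrow> real^3" where
  "reflect3 l x = vector [x $ 1, x $ 2, 2 * l - x $ 3]"

text \<open>\<open>D\<close> is a subset of a horizontal plane, and \<open>h x\<close> is the height above that plane.\<close>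

definition vertical_graph_over :: "(real^3) set \<Rightarrow> (real^3) set \<Rightarrow> bool" where
  "vertical_graph_over \<Sigma> D \<longleftrightarrow> (\<exists>h::real^3 \<Rightarrow> real. \<Sigma> = (\<lambda>x. x + h x *\<^sub>R axis 3 1) ` D)"

end

theory Submission
  imports Defs
begin

text \<open>
  If \<open>curl u = \<alpha> e\<^sub>3\<close> throughout space-time, the vorticity equation collapses to
  \<open>\<alpha> \<partial>\<^sub>3 u = 0\<close>, and the first two components of \<open>curl u = \<alpha> e\<^sub>3\<close> then give
  \<open>\<partial>\<^sub>1 u\<^sub>3 = \<partial>\<^sub>2 u\<^sub>3 = 0\<close> (\<open>partial_deriv_3_u\<close>, \<open>partial_deriv_u_3\<close>). So \<open>u\<close> is constant along
  vertical segments, and \<open>u\<^sub>3\<close> is constant on the convex set \<open>\<Omega>0\<close>, hence zero because its mean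
  vanishes. As \<open>u\<^sub>3\<close> is locally constant in space at all times, \<open>\<partial>\<^sub>t u\<^sub>3\<close> is constant on \<open>\<Omega>0\<close>
  at time 0, and the vertical momentum equation says that \<open>\<partial>\<^sub>3 p\<close> is constant there. Since
  \<open>p = \<sigma> H\<close> on the boundary, the mean curvatures at the two ends of a vertical chord of \<open>\<Omega>0\<close>
  differ by \<open>\<mu>\<close> times the length of the chord, with one constant \<open>\<mu>\<close>
  (\<open>curvature_gap_proportional\<close>).

  The rest is geometry. Let \<open>D\<close> be the projection of \<open>\<Omega>0\<close> to the horizontal plane, so that \<open>\<Omega>0\<close>
  is the region \<open>lo < x\<^sub>3 < up\<close> over \<open>D\<close>. The horizontal part of the outer normal along the upper
  or the lower boundary, as a planar field on \<open>D\<close>, has the mean curvature as its divergence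
  (\<open>mean_curvature_sheet\<close>). Let \<open>X\<close> be the difference of these two fields, upper minus lower
  (\<open>tilt_gap\<close>). The gradients of \<open>up\<close> and \<open>lo\<close> blow up at the boundary of \<open>D\<close>, but by strict
  convexity the two ends of a chord merge there, so \<open>X\<close> tends to 0, and the divergence theorem holds
  without boundary term for \<open>X\<close> and for its bounded multiples. First, \<open>\<integral> div X = 0\<close> with
  \<open>div X = \<mu> (up - lo)\<close> forces \<open>\<mu> = 0\<close>. Then \<open>\<integral> (up + lo) div X = 0\<close> becomes
  \<open>\<integral> X \<bullet> \<nabla>(up + lo) = 0\<close>. The integrand has a sign, because \<open>q \<mapsto> q / sqrt (1 + |q|\<^sup>2)\<close> is
  strictly monotone, and it vanishes only where \<open>\<nabla>(up + lo) = 0\<close> (\<open>slope_sum_tilt_gap\<close>). Hence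
  \<open>up + lo\<close> is a constant \<open>2 l\<close> (\<open>midheight_constant\<close>), which is the symmetry.

  Both uses of the divergence theorem are instances of \<open>nonneg_divergence_eq_0\<close>: a continuous field
  that vanishes outside a bounded convex open set and has nonnegative divergence inside it has
  divergence zero. The sign of the divergence replaces any assumption of integrability.
\<close>

section \<open>Nonnegative divergence of fields vanishing outside a convex set\<close>

text \<open>Shrinking \<open>D\<close> towards \<open>a\<close> by the factor \<open>1 - r / \<rho>\<close> moves every point to distance at least \<open>r\<close>
  from the complement, since the ball of radius \<open>\<rho>\<close> around \<open>a\<close> is dragged along by convexity. So
  the strip is contained in the difference of \<open>D\<close> and its shrunken copy, and Bernoulli's inequality
  bounds the loss of volume linearly in \<open>r\<close>.\<close>

lemma measure_boundary_strip_le: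
  fixes D :: "'a::euclidean_space set"
  assumes "open D" "convex D" "bounded D" and \<rho>: "0 < \<rho>" "ball a \<rho> \<subseteq> D" and r: "0 \<le> r"
  shows "measure lebesgue {x\<in>D. infdist x (- D) < r} \<le> DIM('a) * (r / \<rho>) * measure lebesgue D"
proof -
  define S where "S = {x\<in>D. infdist x (- D) < r}"
  have DL: "D \<in> lmeasurable" using assms lmeasurable_open by blast
  have "open ({x. infdist x (- D) < r})"
    by (intro open_Collect_less continuous_intros)
  moreover have "S = D \<inter> {x. infdist x (- D) < r}" unfolding S_def by auto
  ultimately have oS: "open S" using \<open>open D\<close> by auto
  have SD: "S \<subseteq> D" unfolding S_def by auto
  have SL: "S \<in> lmeasurable" using oS SD assms(3) bounded_subset lmeasurable_open by blast
  have aD: "a \<in> D" using \<rho> by auto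
  show ?thesis
  proof (cases "r < \<rho>")
    case False
    have "1 \<le> real DIM('a)" by (simp add: Suc_leI)
    moreover have "1 \<le> r / \<rho>" using False \<rho> by simp
    ultimately have "1 \<le> DIM('a) * (r / \<rho>)"
      using mult_mono[of 1 "real DIM('a)" 1 "r / \<rho>"] by simp
    then have "measure lebesgue D \<le> DIM('a) * (r / \<rho>) * measure lebesgue D"
      using mult_right_mono[of 1 "DIM('a) * (r / \<rho>)" "measure lebesgue D"] by simp
    moreover have "measure lebesgue S \<le> measure lebesgue D"
      using measure_mono_fmeasurable[OF SD _ DL] SL by auto
    ultimately show ?thesis unfolding S_def by linarith
  next
    case True
    define s where "s = r / \<rho>"
    have s: "0 \<le> s" "s < 1" using True \<rho> r unfolding s_def by auto
    have sr: "s * \<rho> = r" using \<rho> unfolding s_def by auto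
    define T where "T = (\<lambda>x. (1 - s) *\<^sub>R x + s *\<^sub>R a) ` D"
    have TD: "T \<subseteq> D"
    proof
      fix y assume "y \<in> T"
      then obtain x where "x \<in> D" "y = (1 - s) *\<^sub>R x + s *\<^sub>R a" unfolding T_def by auto
      then show "y \<in> D" using convexD_alt[OF \<open>convex D\<close> \<open>x \<in> D\<close> aD, of s] s by auto
    qed
    have T_far: "r \<le> infdist y (- D)" if "y \<in> T" for y
    proof -
      have ne: "- D \<noteq> {}" using \<open>bounded D\<close> by (metis Compl_eq_Diff_UNIV Diff_eq_empty_iff bounded_subset not_bounded_UNIV)
      obtain x where x: "x \<in> D" "y = (1 - s) *\<^sub>R x + s *\<^sub>R a" using \<open>y \<in> T\<close> unfolding T_def by auto
      have "r \<le> dist y z" if "z \<in> - D" for z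
      proof (rule ccontr)
        assume "\<not> r \<le> dist y z"
        then have d: "dist y z < r" by simp
        then have s0: "0 < s" using s sr by (metis less_eq_real_def mult_zero_left not_less zero_le_dist)
        \<comment> \<open>\<open>z\<close> is the same convex combination as \<open>y\<close>, with \<open>a\<close> displaced by \<open>w\<close>.\<close>
        define w where "w = (z - y) /\<^sub>R s"
        have "norm w = dist y z / s" using s0 unfolding w_def by (simp add: dist_norm norm_minus_commute divide_inverse)
        also have "\<dots> < \<rho>" using d s0 sr by (simp add: pos_divide_less_eq mult.commute)
        finally have "norm w < \<rho>" .
        then have "a + w \<in> D" using \<rho> by (auto simp: dist_norm subset_iff)
        then have "(1 - s) *\<^sub>R x + s *\<^sub>R (a + w) \<in> D"
          using convexD_alt[OF \<open>convex D\<close> x(1)] s by auto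
        moreover have "(1 - s) *\<^sub>R x + s *\<^sub>R (a + w) = z"
          using x(2) s0 unfolding w_def by (simp add: algebra_simps)
        ultimately show False using that by auto
      qed
      then show ?thesis using ne by (auto simp: infdist_def intro!: cINF_greatest)
    qed
    have "S \<subseteq> D - T" using SD T_far unfolding S_def by force
    have T_meas: "measure lebesgue T = (1 - s) ^ DIM('a) * measure lebesgue D"
      unfolding T_def using measure_lebesgue_affine[of "1 - s" "s *\<^sub>R a" D] s by simp
    have TL: "T \<in> lmeasurable"
    proof -
      have "T = (+) (s *\<^sub>R a) ` ((\<lambda>x. (1-s) *\<^sub>R x) ` D)" unfolding T_def image_image by (simp add: add.commute)
      moreover have "open ((\<lambda>x. (1-s) *\<^sub>R x) ` D)" using s \<open>open D\<close> by (intro open_scaling) auto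
      ultimately have "open T" using open_translation by metis
      then show ?thesis using TD assms(3) bounded_subset lmeasurable_open by blast
    qed
    have "measure lebesgue S \<le> measure lebesgue (D - T)"
      using \<open>S \<subseteq> D - T\<close> SL DL TL by (intro measure_mono_fmeasurable) auto
    also have "\<dots> = measure lebesgue D - measure lebesgue T"
      using measurable_measure_Diff[OF DL _ TD] TL by auto
    also have "\<dots> = (1 - (1 - s) ^ DIM('a)) * measure lebesgue D"
      unfolding T_meas by (simp add: algebra_simps)
    also have "\<dots> \<le> (DIM('a) * s) * measure lebesgue D"
    proof (rule mult_right_mono)
      show "1 - (1 - s) ^ DIM('a) \<le> DIM('a) * s"
        using Bernoulli_inequality[of "-s" "DIM('a)"] s by simp
    qed simp
    finally show ?thesis unfolding S_def s_def .
  qed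
qed

lemma integral_translate:
  fixes f :: "'a::euclidean_space \<Rightarrow> real"
  assumes [measurable]: "f \<in> borel_measurable borel"
  shows "(LINT x|lborel. f (c + x)) = (LINT x|lborel. f x)"
proof -
  have "(LINT x|lborel. f x) = (LINT x|distr lborel borel ((+) c). f x)"
    by (simp add: lborel_distr_plus)
  also have "\<dots> = (LINT x|lborel. f (c + x))"
    by (rule integral_distr) auto
  finally show ?thesis by simp
qed

lemma integrable_continuous_compact_support:
  fixes f :: "'a::euclidean_space \<Rightarrow> real"
  assumes "compact K" "continuous_on K f" "\<And>x. x \<notin> K \<Longrightarrow> f x = 0"
  shows "integrable lborel f"
proof -
  have "(\<lambda>x. indicator K x *\<^sub>R f x) = f" using assms(3) by (auto simp: indicator_def fun_eq_iff)
  then show ?thesis using borel_integrable_compact[OF assms(1,2)] by simp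
qed

text \<open>Integration by parts against a Lipschitz cutoff \<open>\<eta>\<close>. Both sides are approximated by difference
  quotients: by translation invariance of the integral, the difference quotient of \<open>g\<close> can be moved
  onto \<open>\<eta>\<close>, where it is at most \<open>L\<close> and vanishes unless \<open>\<eta>\<close> changes, that is, outside \<open>S\<close>. In this
  way \<open>\<eta>\<close> never has to be differentiated. The mean value theorem bounds the difference quotients of
  \<open>g\<close> on the support of \<open>\<eta>\<close>, so that dominated convergence applies.\<close>

lemma abs_integral_cutoff_directional_derivative_le:
  fixes g g' \<eta> :: "'a::euclidean_space \<Rightarrow> real" and b :: 'a
  assumes D: "open D" and K: "compact K" "K \<subseteq> D"
    and g: "continuous_on UNIV g"
    and g': "continuous_on D g'" "\<And>x. x \<in> D \<Longrightarrow> ((\<lambda>s. g (x + s *\<^sub>R b)) has_real_derivative g' x) (at 0)"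
    and \<eta>: "continuous_on UNIV \<eta>" "\<And>x. x \<notin> K \<Longrightarrow> \<eta> x = 0"
    and lip: "\<And>x \<epsilon>. 0 < \<epsilon> \<Longrightarrow> \<bar>\<eta> (x - \<epsilon> *\<^sub>R b) - \<eta> x\<bar> \<le> L * \<epsilon>"
    and S: "S \<in> fmeasurable lborel" "r0 > 0"
      "\<And>x \<epsilon>. 0 < \<epsilon> \<Longrightarrow> \<epsilon> < r0 \<Longrightarrow> g x \<noteq> 0 \<Longrightarrow> \<eta> (x - \<epsilon> *\<^sub>R b) \<noteq> \<eta> x \<Longrightarrow> x \<in> S"
    and M: "\<And>x. x \<in> S \<Longrightarrow> \<bar>g x\<bar> \<le> M"
    and b: "norm b = 1"
  shows "\<bar>LINT x|lborel. \<eta> x * g' x\<bar> \<le> L * M * measure lborel S"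
proof -
  obtain d where d: "d > 0" "(\<Union>x\<in>K. cball x d) \<subseteq> D"
    using compact_subset_open_imp_cball_epsilon_subset[OF K(1) D K(2)] by blast
  \<comment> \<open>A compact neighbourhood of the support, in which the short segments in direction \<open>b\<close> stay.\<close>
  define K' where "K' = {x + y | x y. x \<in> K \<and> y \<in> cball 0 d}"
  have K': "compact K'" unfolding K'_def using K by (intro compact_sums) auto
  have K'D: "K' \<subseteq> D" using d(2) unfolding K'_def by (force simp: subset_iff dist_norm)
  have mem_K': "x + t *\<^sub>R b \<in> K'" if "x \<in> K" "\<bar>t\<bar> \<le> d" for x t
    unfolding K'_def using that b by force
  obtain C where C: "\<And>x. x \<in> K' \<Longrightarrow> \<bar>g' x\<bar> \<le> C"
  proof -
    have "compact (g' ` K')" using K' K'D g'(1) by (meson compact_continuous_image continuous_on_subset)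
    then have "bounded (g' ` K')" by (rule compact_imp_bounded)
    then show thesis using that unfolding bounded_iff by auto
  qed
  obtain E where E: "\<And>x. \<bar>\<eta> x\<bar> \<le> E" "E \<ge> 0"
  proof -
    have "compact (\<eta> ` K)" using K \<eta>(1) by (meson compact_continuous_image continuous_on_subset subset_UNIV)
    then have "bounded (\<eta> ` K)" by (rule compact_imp_bounded)
    then obtain B where "\<And>x. x \<in> K \<Longrightarrow> \<bar>\<eta> x\<bar> \<le> B" unfolding bounded_iff by auto
    then have "\<bar>\<eta> x\<bar> \<le> max B 0" for x using \<eta>(2)[of x] by (cases "x \<in> K") (force, simp)
    then show thesis using that[of "max B 0"] by auto
  qed
  have deriv: "((\<lambda>s. g (x + s *\<^sub>R b)) has_real_derivative g' (x + t *\<^sub>R b)) (at t)"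
    if "x + t *\<^sub>R b \<in> D" for x t
  proof -
    have "((\<lambda>s. g ((x + t *\<^sub>R b) + s *\<^sub>R b)) has_real_derivative g' (x + t *\<^sub>R b)) (at (t - t))"
      using g'(2)[OF that] by simp
    then have "((\<lambda>s. g ((x + t *\<^sub>R b) + (s - t) *\<^sub>R b)) has_real_derivative g' (x + t *\<^sub>R b)) (at t)"
      using DERIV_shift[of "\<lambda>s. g ((x + t *\<^sub>R b) + s *\<^sub>R b)" "g' (x + t *\<^sub>R b)" t "- t"] by simp
    moreover have "(\<lambda>s. g ((x + t *\<^sub>R b) + (s - t) *\<^sub>R b)) = (\<lambda>s. g (x + s *\<^sub>R b))"
      by (simp add: algebra_simps)
    ultimately show ?thesis by simp
  qed
  define m where "m = min d r0"
  have m: "m > 0" "m \<le> d" "m \<le> r0" using d S unfolding m_def by auto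
  define e where "e n = m / (real n + 2)" for n
  have e: "0 < e n" "e n < m" for n using m(1) mult_pos_pos[of m "real n + 1"] unfolding e_def by (auto simp: field_simps add_pos_nonneg)
  have e_lim: "e \<longlonglongrightarrow> 0"
  proof -
    have "(\<lambda>n. m * inverse (real (Suc (Suc n)))) \<longlonglongrightarrow> m * 0"
      by (rule tendsto_mult[OF tendsto_const LIMSEQ_Suc[OF LIMSEQ_inverse_real_of_nat]])
    then show ?thesis unfolding e_def by (simp add: divide_inverse add.commute)
  qed
  define F where "F n x = \<eta> x * ((g (x + e n *\<^sub>R b) - g x) / e n)" for n x
  have cont_F: "continuous_on UNIV (F n)" for n
    unfolding F_def using g \<eta>(1) e[of n]
    by (auto intro!: continuous_intros continuous_on_compose2[OF g])
  have F0: "F n x = 0" if "x \<notin> K" for n x using \<eta>(2)[OF that] unfolding F_def by simp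
  have F_le: "\<bar>F n x\<bar> \<le> E * C * indicator K x" for n x
  proof (cases "x \<in> K")
    case True
    have "\<exists>z. 0 < z \<and> z < e n \<and> g (x + e n *\<^sub>R b) - g (x + 0 *\<^sub>R b) = (e n - 0) * g' (x + z *\<^sub>R b)"
    proof (rule MVT2)
      show "0 < e n" by (rule e)
      fix t assume "0 \<le> t" "t \<le> e n"
      then have "x + t *\<^sub>R b \<in> D" using mem_K'[OF True, of t] e[of n] m K'D by auto
      then show "((\<lambda>s. g (x + s *\<^sub>R b)) has_real_derivative g' (x + t *\<^sub>R b)) (at t)" by (rule deriv)
    qed
    then obtain z where z: "0 < z" "z < e n" "g (x + e n *\<^sub>R b) - g x = e n * g' (x + z *\<^sub>R b)" by auto
    then have "F n x = \<eta> x * g' (x + z *\<^sub>R b)" unfolding F_def using e[of n] by simp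
    moreover have "\<bar>g' (x + z *\<^sub>R b)\<bar> \<le> C" using C mem_K'[OF True, of z] z e[of n] m by simp
    ultimately show ?thesis using E(1)[of x] E(2) True by (simp add: abs_mult mult_mono)
  qed (simp add: F0)
  have meas_ind: "integrable lborel (\<lambda>x. E * C * indicator K x)"
    using K(1) emeasure_compact_finite[OF K(1)]
    by (intro integrable_mult_right integrable_real_indicator) (auto simp: borel_compact)
  have lim: "(\<lambda>n. LINT x|lborel. F n x) \<longlonglongrightarrow> (LINT x|lborel. \<eta> x * g' x)"
  proof (rule integral_dominated_convergence[OF _ _ meas_ind])
    have "continuous_on K (\<lambda>x. \<eta> x * g' x)"
      using \<eta>(1) g'(1) K(2) by (auto intro!: continuous_intros intro: continuous_on_subset)
    from integrable_continuous_compact_support[OF K(1) this]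
    show "(\<lambda>x. \<eta> x * g' x) \<in> borel_measurable lborel" using \<eta>(2) by auto
    show "F n \<in> borel_measurable lborel" for n
      using borel_measurable_continuous_onI[OF cont_F] by simp
    show "AE x in lborel. (\<lambda>n. F n x) \<longlonglongrightarrow> \<eta> x * g' x"
    proof (rule AE_I2)
      fix x
      show "(\<lambda>n. F n x) \<longlonglongrightarrow> \<eta> x * g' x"
      proof (cases "x \<in> K")
        case True
        then have "((\<lambda>h. (g (x + h *\<^sub>R b) - g x) / h) \<longlongrightarrow> g' x) (at 0)"
          using g'(2)[of x] K unfolding DERIV_def by auto
        moreover have "filterlim e (at 0) sequentially"
          using e_lim e by (auto simp: filterlim_at intro!: always_eventually) (metis less_irrefl)
        ultimately have "(\<lambda>n. (g (x + e n *\<^sub>R b) - g x) / e n) \<longlonglongrightarrow> g' x"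
          using filterlim_compose by fastforce
        then show ?thesis unfolding F_def by (intro tendsto_intros)
      qed (simp add: F_def \<eta>(2))
    qed
    show "AE x in lborel. norm (F n x) \<le> E * C * indicator K x" for n
      using F_le by auto
  qed
  have bound: "\<bar>LINT x|lborel. F n x\<bar> \<le> L * M * measure lborel S" for n
  proof -
    let ?h = "e n"
    have i1: "integrable lborel (\<lambda>x. \<eta> x * g x)"
      using \<eta> g K by (intro integrable_continuous_compact_support[OF K(1)])
        (auto intro!: continuous_intros intro: continuous_on_subset)
    have i2: "integrable lborel (\<lambda>x. \<eta> x * g (x + ?h *\<^sub>R b))"
      using \<eta> by (intro integrable_continuous_compact_support[OF K(1)])
        (auto intro!: continuous_intros continuous_on_compose2[OF g] intro: continuous_on_subset)
    have c3: "continuous_on UNIV (\<lambda>x. \<eta> (x - ?h *\<^sub>R b) * g x)"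
      by (auto intro!: continuous_intros g continuous_on_compose2[OF \<eta>(1)])
    have cK: "compact ((\<lambda>x. x + ?h *\<^sub>R b) ` K)"
      using K(1) by (intro compact_continuous_image continuous_intros)
    have i3: "integrable lborel (\<lambda>x. \<eta> (x - ?h *\<^sub>R b) * g x)"
    proof (rule integrable_continuous_compact_support[OF cK])
      fix x assume "x \<notin> (\<lambda>x. x + ?h *\<^sub>R b) ` K"
      then have "x - ?h *\<^sub>R b \<notin> K" by (metis diff_add_cancel imageI)
      then show "\<eta> (x - ?h *\<^sub>R b) * g x = 0" using \<eta>(2) by simp
    qed (use c3 continuous_on_subset in blast)
    have tr: "(LINT x|lborel. \<eta> x * g (x + ?h *\<^sub>R b)) = (LINT x|lborel. \<eta> (x - ?h *\<^sub>R b) * g x)"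
    proof -
      have "(LINT x|lborel. \<eta> ((?h *\<^sub>R b + x) - ?h *\<^sub>R b) * g (?h *\<^sub>R b + x))
          = (LINT x|lborel. \<eta> (x - ?h *\<^sub>R b) * g x)"
        by (rule integral_translate[where f = "\<lambda>x. \<eta> (x - ?h *\<^sub>R b) * g x"])
          (rule borel_measurable_continuous_onI[OF c3])
      then show ?thesis by (simp add: add.commute)
    qed
    have "(LINT x|lborel. F n x) = (LINT x|lborel. (\<eta> x * g (x + ?h *\<^sub>R b) - \<eta> x * g x) / ?h)"
      unfolding F_def by (simp add: algebra_simps)
    also have "\<dots> = ((LINT x|lborel. \<eta> x * g (x + ?h *\<^sub>R b)) - (LINT x|lborel. \<eta> x * g x)) / ?h"
      using i1 i2 by simp
    also have "\<dots> = (LINT x|lborel. (\<eta> (x - ?h *\<^sub>R b) * g x - \<eta> x * g x) / ?h)"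
      unfolding tr using i1 i3 by simp
    finally have eq: "(LINT x|lborel. F n x) = (LINT x|lborel. (\<eta> (x - ?h *\<^sub>R b) * g x - \<eta> x * g x) / ?h)" .
    have "\<bar>LINT x|lborel. F n x\<bar> \<le> (LINT x|lborel. L * M * indicator S x)"
      unfolding eq
    proof (rule integral_abs_bound_integral)
      show "integrable lborel (\<lambda>x. (\<eta> (x - ?h *\<^sub>R b) * g x - \<eta> x * g x) / ?h)" using i1 i3 by simp
      show "integrable lborel (\<lambda>x. L * M * indicator S x)"
        using S(1) by (intro integrable_mult_right integrable_real_indicator) (auto simp: fmeasurable_def)
      fix x
      show "\<bar>(\<eta> (x - ?h *\<^sub>R b) * g x - \<eta> x * g x) / ?h\<bar> \<le> L * M * indicator S x"
      proof (cases "g x \<noteq> 0 \<and> \<eta> (x - ?h *\<^sub>R b) \<noteq> \<eta> x")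
        case True
        then have xS: "x \<in> S" using S(3)[of ?h x] e[of n] m by auto
        have "\<bar>(\<eta> (x - ?h *\<^sub>R b) * g x - \<eta> x * g x) / ?h\<bar> = \<bar>\<eta> (x - ?h *\<^sub>R b) - \<eta> x\<bar> / ?h * \<bar>g x\<bar>"
          using e[of n] by (simp add: abs_mult left_diff_distrib[symmetric])
        also have "\<dots> \<le> L * M"
        proof (rule mult_mono)
          show "\<bar>\<eta> (x - ?h *\<^sub>R b) - \<eta> x\<bar> / ?h \<le> L" using lip[of ?h x] e[of n] by (simp add: field_simps)
          then show "0 \<le> L" using e[of n] by (meson abs_ge_zero divide_nonneg_pos order_trans)
        qed (use M[OF xS] in auto)
        finally show ?thesis using xS by simp
      next
        case False
        have "0 \<le> L" using lip[of 1 x] by (auto intro: order_trans[OF abs_ge_zero])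
        moreover have "0 \<le> M * indicator S x" using M[of x] by (auto simp: indicator_def intro: order_trans[OF abs_ge_zero])
        ultimately have "0 \<le> L * (M * indicator S x)" by (rule mult_nonneg_nonneg)
        then show ?thesis using False by (auto simp: mult.assoc)
      qed
    qed
    also have "\<dots> = L * M * measure lborel S" using S(1) by (simp add: fmeasurable_def)
    finally show ?thesis .
  qed
  have "(\<lambda>n. \<bar>LINT x|lborel. F n x\<bar>) \<longlonglongrightarrow> \<bar>LINT x|lborel. \<eta> x * g' x\<bar>"
    using lim by (rule tendsto_rabs)
  then show ?thesis using bound by (intro Lim_bounded) auto
qed


text \<open>Test the divergence with the cutoff that is 1 at distance \<open>2 r\<close> from the complement and 0 at
  distance \<open>r\<close>. Its Lipschitz constant is \<open>1 / r\<close>, and it varies only in a strip of volume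
  \<open>O(r)\<close>, in which \<open>Y\<close> is uniformly small because it vanishes on the boundary. So the integral of the
  divergence against the cutoff tends to 0, whereas a point with positive divergence would keep it
  bounded below.\<close>

theorem nonneg_divergence_eq_0:
  fixes Y :: "'a::euclidean_space \<Rightarrow> 'a" and d :: "'a \<Rightarrow> 'a \<Rightarrow> real"
  assumes D: "open D" "convex D" "bounded D"
    and Y: "continuous_on UNIV Y" "\<And>x. x \<notin> D \<Longrightarrow> Y x = 0"
    and d: "\<And>b. b \<in> Basis \<Longrightarrow> continuous_on D (d b)"
      "\<And>b x. b \<in> Basis \<Longrightarrow> x \<in> D \<Longrightarrow> ((\<lambda>s. Y (x + s *\<^sub>R b) \<bullet> b) has_real_derivative d b x) (at 0)"
    and nonneg: "\<And>x. x \<in> D \<Longrightarrow> 0 \<le> (\<Sum>b\<in>Basis. d b x)"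
    and x0: "x0 \<in> D"
  shows "(\<Sum>b\<in>Basis. d b x0) = 0"
proof (rule ccontr)
  define dv where "dv x = (\<Sum>b\<in>Basis. d b x)" for x
  assume "(\<Sum>b\<in>Basis. d b x0) \<noteq> 0"
  then have pos: "dv x0 > 0" using nonneg[OF x0] unfolding dv_def by linarith
  have cont_dv: "continuous_on D dv" unfolding dv_def using d(1) by (intro continuous_intros)
  have op: "open {x \<in> D. dv x0 / 2 < dv x}"
  proof -
    have "open (D \<inter> dv -` {dv x0 / 2<..})"
      using continuous_open_preimage[OF cont_dv D(1)] by auto
    moreover have "D \<inter> dv -` {dv x0 / 2<..} = {x \<in> D. dv x0 / 2 < dv x}" by auto
    ultimately show ?thesis by simp
  qed
  then obtain \<rho> where \<rho>: "\<rho> > 0" "ball x0 \<rho> \<subseteq> {x \<in> D. dv x0 / 2 < dv x}"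
    using x0 pos unfolding open_contains_ball by force
  define B where "B = ball x0 (\<rho> / 2)"
  \<comment> \<open>\<open>c\<close> is a lower bound and \<open>\<epsilon> * C\<close> an upper bound for the same integral, with
    \<open>\<epsilon>\<close> a bound for \<open>Y\<close> in the strip.\<close>
  define c where "c = dv x0 / 2 * measure lborel B"
  have c: "c > 0" using pos \<rho> unfolding c_def B_def by (simp add: content_ball_pos)
  define C where "C = (\<Sum>b\<in>(Basis::'a set). DIM('a) * (3 / \<rho>) * measure lebesgue D)"
  have C: "C \<ge> 0" unfolding C_def using \<rho> by (intro sum_nonneg) auto
  define \<epsilon> where "\<epsilon> = c / (2 * (C + 1))"
  have \<epsilon>: "\<epsilon> > 0" "\<epsilon> * C < c" using c C mult_nonneg_nonneg[of C c] unfolding \<epsilon>_def by (auto simp: field_simps add_nonneg_pos)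
  have ne: "- D \<noteq> {}" using D(3) by (metis Compl_eq_Diff_UNIV Diff_eq_empty_iff bounded_subset not_bounded_UNIV)
  obtain t where t: "t > 0" "\<And>x. infdist x (- D) < t \<Longrightarrow> norm (Y x) \<le> \<epsilon>"
  proof -
    define K where "K = {x. \<epsilon> \<le> norm (Y x)}"
    have "closed K" unfolding K_def using Y(1) by (intro closed_Collect_le continuous_intros)
    moreover have KD: "K \<subseteq> D" unfolding K_def using Y(2) \<epsilon> by force
    ultimately have "compact K" using D(3) bounded_subset compact_eq_bounded_closed by blast
    moreover have "closed (- D)" using D(1) by auto
    moreover have "K \<inter> - D = {}" using KD by auto
    ultimately obtain t where t: "t > 0" "\<And>x y. x \<in> K \<Longrightarrow> y \<in> - D \<Longrightarrow> t \<le> dist x y"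
      using separate_compact_closed by metis
    have "norm (Y x) \<le> \<epsilon>" if "infdist x (- D) < t" for x
    proof (rule ccontr)
      assume "\<not> norm (Y x) \<le> \<epsilon>"
      then have "x \<in> K" unfolding K_def by auto
      then have "t \<le> infdist x (- D)" using t(2) ne by (auto simp: infdist_def intro!: cINF_greatest)
      then show False using that by simp
    qed
    then show thesis using that t(1) by blast
  qed
  \<comment> \<open>\<open>r \<le> \<rho> / 4\<close> makes the cutoff equal to 1 on \<open>B\<close>; \<open>3 * r \<le> t\<close> makes \<open>Y\<close> small on \<open>S\<close>, whose
    width exceeds \<open>2 * r\<close> to leave room for translations by less than \<open>r\<close>.\<close>
  define r where "r = min (\<rho> / 4) (t / 3)"
  have r: "r > 0" "r \<le> \<rho> / 4" "3 * r \<le> t" using \<rho> t unfolding r_def by auto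
  define \<eta> where "\<eta> x = max 0 (min 1 (infdist x (- D) / r - 1))" for x
  define K where "K = {x. r \<le> infdist x (- D)}"
  have K: "compact K" "K \<subseteq> D"
  proof -
    have "closed K" unfolding K_def by (intro closed_Collect_le continuous_intros)
    moreover show KD: "K \<subseteq> D" 
      unfolding K_def using r D(1) ne by (force simp: in_closed_iff_infdist_zero[of "- D"])
    ultimately show "compact K" using D(3) bounded_subset compact_eq_bounded_closed by blast
  qed
  have \<eta>: "continuous_on UNIV \<eta>" "\<And>x. x \<notin> K \<Longrightarrow> \<eta> x = 0"
    unfolding \<eta>_def K_def using r by (auto intro!: continuous_intros simp: field_simps)
  have \<eta>_nonneg: "0 \<le> \<eta> x" for x unfolding \<eta>_def by simp
  define S where "S = {x\<in>D. infdist x (- D) < 3 * r}"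
  have "open ({x. infdist x (- D) < 3 * r})"
    by (intro open_Collect_less continuous_intros)
  moreover have "S = D \<inter> {x. infdist x (- D) < 3 * r}" unfolding S_def by auto
  ultimately have oS: "open S" using D(1) by auto
  have bS: "bounded S" using D(3) unfolding S_def by (rule bounded_subset) auto
  have S: "S \<in> fmeasurable lborel"
    using oS emeasure_bounded_finite[OF bS] by (auto simp: fmeasurable_def)
  have meas_S: "measure lborel S \<le> DIM('a) * (3 * r / \<rho>) * measure lebesgue D"
    using measure_boundary_strip_le[OF D \<rho>(1), of x0 "3 * r"] \<rho>(2) r oS
    unfolding S_def by (auto simp: subset_iff)
  have est: "\<bar>LINT x|lborel. \<eta> x * d b x\<bar> \<le> \<epsilon> * (DIM('a) * (3 / \<rho>) * measure lebesgue D)"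
    if b: "b \<in> Basis" for b
  proof -
    have nb: "norm b = 1" using b by simp
    have "\<bar>LINT x|lborel. \<eta> x * d b x\<bar> \<le> (1 / r) * \<epsilon> * measure lborel S"
    proof (rule abs_integral_cutoff_directional_derivative_le[where g = "\<lambda>x. Y x \<bullet> b" and b = b and K = K and ?r0.0 = r])
      show "continuous_on UNIV (\<lambda>x. Y x \<bullet> b)" using Y(1) by (intro continuous_intros)
      fix x and h :: real assume h: "0 < h"
      have tri: "\<bar>infdist (x - h *\<^sub>R b) (- D) - infdist x (- D)\<bar> \<le> h"
        using infdist_triangle_abs[of "x - h *\<^sub>R b" "- D" x] nb h by (simp add: dist_norm)
      have "\<bar>\<eta> (x - h *\<^sub>R b) - \<eta> x\<bar> \<le> \<bar>infdist (x - h *\<^sub>R b) (- D) / r - infdist x (- D) / r\<bar>"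
        unfolding \<eta>_def by linarith
      also have "\<dots> = \<bar>infdist (x - h *\<^sub>R b) (- D) - infdist x (- D)\<bar> / r"
        using r by (simp add: diff_divide_distrib[symmetric])
      also have "\<dots> \<le> h / r" using tri r by (intro divide_right_mono) auto
      finally show "\<bar>\<eta> (x - h *\<^sub>R b) - \<eta> x\<bar> \<le> 1 / r * h" by simp
      assume hr: "h < r" and g: "Y x \<bullet> b \<noteq> 0" and ne: "\<eta> (x - h *\<^sub>R b) \<noteq> \<eta> x"
      have "x \<in> D" using g Y(2) by force
      moreover have "infdist x (- D) < 3 * r"
      proof (rule ccontr)
        assume "\<not> infdist x (- D) < 3 * r"
        then have "2 * r \<le> infdist x (- D) \<and> 2 * r \<le> infdist (x - h *\<^sub>R b) (- D)"
          using tri hr r by linarith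
        then have "1 \<le> infdist x (- D) / r - 1" "1 \<le> infdist (x - h *\<^sub>R b) (- D) / r - 1"
          using r by (auto simp: field_simps)
        then show False using ne unfolding \<eta>_def by auto
      qed
      ultimately show "x \<in> S" unfolding S_def by auto
    next
      fix x assume "x \<in> S"
      then have "norm (Y x) \<le> \<epsilon>" using t r unfolding S_def by auto
      then show "\<bar>Y x \<bullet> b\<bar> \<le> \<epsilon>" using Cauchy_Schwarz_ineq2[of "Y x" b] nb by simp
    qed (use D K \<eta> d b S r nb in auto)
    also have "\<dots> \<le> (1 / r) * \<epsilon> * (DIM('a) * (3 * r / \<rho>) * measure lebesgue D)"
      using r \<epsilon> by (intro mult_left_mono meas_S) auto
    also have "\<dots> = \<epsilon> * (DIM('a) * (3 / \<rho>) * measure lebesgue D)" using r by simp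
    finally show ?thesis .
  qed
  have int: "integrable lborel (\<lambda>x. \<eta> x * d b x)" if "b \<in> Basis" for b
    using \<eta> d(1)[OF that] K by (intro integrable_continuous_compact_support[OF K(1)])
      (auto intro!: continuous_intros intro: continuous_on_subset)
  have "c = (LINT x|lborel. dv x0 / 2 * indicator B x)" unfolding c_def B_def by simp
  also have "\<dots> \<le> (LINT x|lborel. (\<Sum>b\<in>Basis. \<eta> x * d b x))"
  proof (rule integral_mono)
    show "integrable lborel (\<lambda>x. dv x0 / 2 * indicator B x)"
      using emeasure_bounded_finite[OF bounded_ball, of x0 "\<rho> / 2"]
      unfolding B_def by (intro integrable_mult_right integrable_real_indicator) auto
    show "integrable lborel (\<lambda>x. \<Sum>b\<in>Basis. \<eta> x * d b x)" using int by auto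
    fix x
    have eq: "(\<Sum>b\<in>Basis. \<eta> x * d b x) = \<eta> x * dv x" unfolding dv_def by (simp add: sum_distrib_left)
    show "dv x0 / 2 * indicator B x \<le> (\<Sum>b\<in>Basis. \<eta> x * d b x)"
    proof (cases "x \<in> B")
      case True
      have "\<rho> / 2 \<le> infdist x (- D)"
        unfolding infdist_notempty[OF ne]
      proof (rule cINF_greatest[OF ne])
        fix y assume "y \<in> - D"
        then have "y \<notin> ball x0 \<rho>" using \<rho>(2) by auto
        then show "\<rho> / 2 \<le> dist x y" using True dist_triangle[of x0 y x] unfolding B_def by auto
      qed
      then have "1 \<le> infdist x (- D) / r - 1" using r by (auto simp: field_simps)
      then have "\<eta> x = 1" unfolding \<eta>_def by auto
      moreover have "dv x0 / 2 < dv x" using True \<rho> unfolding B_def by (auto simp: subset_iff)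
      ultimately show ?thesis using True eq by simp
    next
      case False
      have "0 \<le> \<eta> x * dv x"
      proof (cases "x \<in> D")
        case True
        then show ?thesis using nonneg \<eta>_nonneg unfolding dv_def by auto
      qed (use \<eta>(2) K in force)
      then show ?thesis using False eq by simp
    qed
  qed
  also have "\<dots> = (\<Sum>b\<in>Basis. LINT x|lborel. \<eta> x * d b x)" using int by (rule Bochner_Integration.integral_sum)
  also have "\<dots> \<le> (\<Sum>b\<in>(Basis::'a set). \<epsilon> * (DIM('a) * (3 / \<rho>) * measure lebesgue D))"
    by (intro sum_mono order_trans[OF abs_ge_self est])
  also have "\<dots> = \<epsilon> * C" unfolding C_def by (simp add: sum_distrib_left)
  finally show False using \<epsilon>(2) by simp
qed

section \<open>Calculus of continuously differentiable functions\<close>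

lemma linear_eq_sum_Basis:
  fixes L :: "'a::euclidean_space \<Rightarrow> 'b::real_vector"
  assumes "linear L" shows "L v = (\<Sum>b\<in>Basis. (v \<bullet> b) *\<^sub>R L b)"
proof -
  have "L v = L (\<Sum>b\<in>Basis. (v \<bullet> b) *\<^sub>R b)" by (simp add: euclidean_representation)
  also have "\<dots> = (\<Sum>b\<in>Basis. (v \<bullet> b) *\<^sub>R L b)"
    using assms by (simp add: linear_sum linear_cmul)
  finally show ?thesis .
qed

lemma Ck_on_Suc_imp: "Ck_on (Suc k) f U \<Longrightarrow> Ck_on k f U"
proof (induction k arbitrary: f)
  case 0
  then show ?case
    by (auto intro!: continuous_at_imp_continuous_on differentiable_imp_continuous_within)
next
  case (Suc k)
  have "f differentiable at x" if "x \<in> U" for x using Suc.prems that by (simp only: Ck_on.simps)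
  moreover have "Ck_on k (\<lambda>x. frechet_derivative f (at x) v) U" for v
    using Suc.prems Ck_on.simps(2)[of "Suc k" f U] by (intro Suc.IH) blast
  ultimately show ?case by simp
qed

lemma Ck_on_antimono:
  assumes "Ck_on m f U" "k \<le> m" shows "Ck_on k f U"
  using assms(2,1) by (induction rule: inc_induct) (auto intro: Ck_on_Suc_imp)

lemma Ck_boundary_antimono:
  assumes "Ck_boundary m \<Omega>" "k \<le> m" shows "Ck_boundary k \<Omega>"
  using assms Ck_on_antimono unfolding Ck_boundary_def defining_function_def by meson

lemma Ck_on_1D:
  assumes "Ck_on 1 f U"
  shows "x \<in> U \<Longrightarrow> (f has_derivative frechet_derivative f (at x)) (at x)"
    and "continuous_on U (\<lambda>x. frechet_derivative f (at x) v)"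
proof -
  have *: "(\<forall>x\<in>U. f differentiable (at x)) \<and> (\<forall>v. continuous_on U (\<lambda>x. frechet_derivative f (at x) v))"
    using assms unfolding One_nat_def Ck_on.simps .
  show "x \<in> U \<Longrightarrow> (f has_derivative frechet_derivative f (at x)) (at x)"
    using * frechet_derivative_works by blast
  show "continuous_on U (\<lambda>x. frechet_derivative f (at x) v)" using * by blast
qed

lemma Ck_on_1I:
  assumes "\<And>x. x \<in> U \<Longrightarrow> (f has_derivative f' x) (at x)"
    and "\<And>v. continuous_on U (\<lambda>x. f' x v)"
  shows "Ck_on 1 f U"
proof -
  have eq: "frechet_derivative f (at x) = f' x" if "x \<in> U" for x
    using frechet_derivative_at[OF assms(1)[OF that]] by simp
  have "continuous_on U (\<lambda>x. frechet_derivative f (at x) v)" for v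
    using assms(2)[of v] by (rule continuous_on_eq) (simp add: eq)
  then show ?thesis using assms(1) by (auto simp: differentiable_def)
qed

lemma Ck_on_1_local:
  assumes "\<And>x. x \<in> U \<Longrightarrow> \<exists>V. open V \<and> x \<in> V \<and> Ck_on 1 f V"
  shows "Ck_on 1 f U"
proof -
  have "f differentiable at x" if "x \<in> U" for x using assms[OF that] by auto
  moreover have "continuous_on U (\<lambda>x. frechet_derivative f (at x) v)" for v
  proof (rule continuous_at_imp_continuous_on, rule ballI)
    fix x assume "x \<in> U"
    then obtain V where V: "open V" "x \<in> V" "Ck_on 1 f V" using assms by blast
    then have "continuous_on V (\<lambda>x. frechet_derivative f (at x) v)" by simp
    with V show "isCont (\<lambda>x. frechet_derivative f (at x) v) x" by (simp add: continuous_on_eq_continuous_at)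
  qed
  ultimately show ?thesis by simp
qed

lemma Ck_on_1_subset: "Ck_on 1 f U \<Longrightarrow> V \<subseteq> U \<Longrightarrow> Ck_on 1 f V"
  using continuous_on_subset[of U _ V] by (auto simp: subset_iff)

lemma Ck_on_1_cong:
  assumes "open U" "\<And>x. x \<in> U \<Longrightarrow> f x = g x" "Ck_on 1 g U"
  shows "Ck_on 1 f U"
proof (rule Ck_on_1I)
  fix x assume x: "x \<in> U"
  show "(f has_derivative frechet_derivative g (at x)) (at x)"
    by (rule has_derivative_transform_within_open[OF Ck_on_1D(1)[OF assms(3) x] assms(1) x])
       (simp add: assms(2))
next
  show "continuous_on U (\<lambda>x. frechet_derivative g (at x) v)" for v
    using assms(3) by simp
qed

text \<open>The derivative of \<open>g\<close> is expanded in a basis, since its continuity is known only for a fixed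
  direction, whereas the chain rule applies it to a direction that varies with the point.\<close>

lemma Ck_on_1_compose:
  fixes g :: "'b::euclidean_space \<Rightarrow> 'c::real_normed_vector" and F :: "'a::euclidean_space \<Rightarrow> 'b"
  assumes g: "Ck_on 1 g U" and F: "Ck_on 1 F V" and "F ` V \<subseteq> U"
  shows "Ck_on 1 (\<lambda>x. g (F x)) V"
proof (rule Ck_on_1I)
  fix x assume x: "x \<in> V"
  then have "F x \<in> U" using assms(3) by auto
  from diff_chain_at[OF Ck_on_1D(1)[OF F x] Ck_on_1D(1)[OF g this]]
  show "((\<lambda>x. g (F x)) has_derivative
      (\<lambda>v. frechet_derivative g (at (F x)) (frechet_derivative F (at x) v))) (at x)"
    by (simp add: o_def)
next
  fix v
  have cF: "continuous_on V F"
    using Ck_on_antimono[OF F, of 0] by simp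
  have "continuous_on V (\<lambda>x. \<Sum>b\<in>Basis. (frechet_derivative F (at x) v \<bullet> b) *\<^sub>R frechet_derivative g (at (F x)) b)"
  proof (intro continuous_intros)
    show "continuous_on V (\<lambda>x. frechet_derivative F (at x) v)" using F by simp
    show "continuous_on V (\<lambda>x. frechet_derivative g (at (F x)) b)" for b
      using g assms(3) cF by (intro continuous_on_compose2[of U "\<lambda>y. frechet_derivative g (at y) b" V F]) auto
  qed
  then show "continuous_on V (\<lambda>x. frechet_derivative g (at (F x)) (frechet_derivative F (at x) v))"
  proof (rule continuous_on_eq)
    fix x assume "x \<in> V"
    then have "F x \<in> U" using assms(3) by auto
    then have "linear (frechet_derivative g (at (F x)))"
      using Ck_on_1D(1)[OF g] has_derivative_linear by blast
    then show "(\<Sum>b\<in>Basis. (frechet_derivative F (at x) v \<bullet> b) *\<^sub>R frechet_derivative g (at (F x)) b)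
        = frechet_derivative g (at (F x)) (frechet_derivative F (at x) v)"
      by (rule linear_eq_sum_Basis[symmetric])
  qed
qed

section \<open>Defining functions and the outer normal\<close>

lemma has_derivative_grad:
  fixes \<phi> :: "'a::euclidean_space \<Rightarrow> real"
  assumes "\<phi> differentiable at x"
  shows "(\<phi> has_derivative (\<lambda>v. grad \<phi> x \<bullet> v)) (at x)"
proof -
  have d: "(\<phi> has_derivative frechet_derivative \<phi> (at x)) (at x)"
    using assms frechet_derivative_works by blast
  have "grad \<phi> x \<bullet> v = (\<Sum>b\<in>Basis. (v \<bullet> b) *\<^sub>R frechet_derivative \<phi> (at x) b)" for v
    by (simp add: grad_def inner_sum_left mult.commute inner_commute[of v])
  then have "frechet_derivative \<phi> (at x) v = grad \<phi> x \<bullet> v" for v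
    using linear_eq_sum_Basis[OF has_derivative_linear[OF d], of v] by simp
  then have "frechet_derivative \<phi> (at x) = (\<lambda>v. grad \<phi> x \<bullet> v)" by auto
  with d show ?thesis by simp
qed

lemma defining_functionD:
  assumes "defining_function k \<Omega> U \<phi>" "1 \<le> k"
  shows "open U" "continuous_on U (grad \<phi>)"
    "\<And>x. x \<in> U \<Longrightarrow> (\<phi> has_derivative (\<lambda>v. grad \<phi> x \<bullet> v)) (at x)"
    "\<And>x. x \<in> U \<Longrightarrow> grad \<phi> x \<noteq> 0" "\<And>x. x \<in> U \<Longrightarrow> x \<in> \<Omega> \<longleftrightarrow> \<phi> x < 0"
    "defining_function 1 \<Omega> U \<phi>"
proof -
  have C1: "Ck_on 1 \<phi> U" using assms Ck_on_antimono unfolding defining_function_def by blast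
  show "open U" "\<And>x. x \<in> U \<Longrightarrow> grad \<phi> x \<noteq> 0" "\<And>x. x \<in> U \<Longrightarrow> x \<in> \<Omega> \<longleftrightarrow> \<phi> x < 0"
    using assms unfolding defining_function_def by auto
  show "continuous_on U (grad \<phi>)"
    using C1 unfolding grad_def by (intro continuous_intros) simp
  show "\<And>x. x \<in> U \<Longrightarrow> (\<phi> has_derivative (\<lambda>v. grad \<phi> x \<bullet> v)) (at x)"
    using C1 by (intro has_derivative_grad) auto
  show "defining_function 1 \<Omega> U \<phi>" using assms C1 unfolding defining_function_def by simp
qed

lemma defining_function_zero:
  assumes "defining_function 1 \<Omega> U \<phi>" "open \<Omega>" "x \<in> U" "x \<in> frontier \<Omega>"
  shows "\<phi> x = 0"
proof -
  note df = defining_functionD[OF assms(1) order_refl]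
  have "x \<notin> \<Omega>" using assms by (auto simp: frontier_def interior_open)
  then have "\<not> \<phi> x < 0" using df(5) assms(3) by auto
  moreover have "\<not> \<phi> x > 0"
  proof
    assume pos: "\<phi> x > 0"
    have "isCont \<phi> x" using df(3)[OF assms(3)] has_derivative_continuous by blast
    then have "\<forall>\<^sub>F y in nhds x. \<phi> y > 0" using pos unfolding isCont_def tendsto_at_iff_tendsto_nhds
      by (auto dest: order_tendstoD(1))
    moreover have "\<forall>\<^sub>F y in nhds x. y \<in> U" using df(1) assms(3) by (rule eventually_nhds_in_open)
    ultimately have "\<forall>\<^sub>F y in nhds x. y \<notin> \<Omega>" by eventually_elim (use df(5) in force)
    then obtain W where "open W" "x \<in> W" "\<forall>y\<in>W. y \<notin> \<Omega>" unfolding eventually_nhds by auto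
    then have "x \<notin> closure \<Omega>" using open_Int_closure_eq_empty[of W \<Omega>] by blast
    then show False using assms(4) by (simp add: frontier_def)
  qed
  ultimately show ?thesis by simp
qed

lemma has_derivative_imp_directional:
  fixes Y :: "'a::real_normed_vector \<Rightarrow> 'b::real_inner"
  assumes "(Y has_derivative Y') (at x)"
  shows "((\<lambda>s. Y (x + s *\<^sub>R v) \<bullet> w) has_real_derivative Y' v \<bullet> w) (at 0)"
proof -
  have lin: "linear Y'" using assms by (rule has_derivative_linear)
  have "((\<lambda>s::real. x + s *\<^sub>R v) has_derivative (\<lambda>s. s *\<^sub>R v)) (at 0)"
    by (auto intro!: derivative_eq_intros)
  from diff_chain_at[OF this, of Y Y'] assms
  have "((\<lambda>s. Y (x + s *\<^sub>R v)) has_derivative (\<lambda>s. Y' (s *\<^sub>R v))) (at 0)" by (simp add: o_def)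
  then have "((\<lambda>s. Y (x + s *\<^sub>R v) \<bullet> w) has_derivative (\<lambda>s. Y' (s *\<^sub>R v) \<bullet> w)) (at 0)"
    by (rule has_derivative_inner_left)
  moreover have "(\<lambda>s. Y' (s *\<^sub>R v) \<bullet> w) = (*) (Y' v \<bullet> w)"
    by (auto simp: linear_cmul[OF lin] mult.commute)
  ultimately show ?thesis unfolding has_field_derivative_def by simp
qed

lemma has_derivative_sign:
  fixes \<phi> :: "'a::real_normed_vector \<Rightarrow> real"
  assumes "(\<phi> has_derivative \<phi>') (at x)"
  shows "\<phi>' v < 0 \<Longrightarrow> \<forall>\<^sub>F t in at_right 0. \<phi> (x + t *\<^sub>R v) < \<phi> x"
    and "\<phi>' v > 0 \<Longrightarrow> \<forall>\<^sub>F t in at_right 0. \<phi> (x + t *\<^sub>R v) > \<phi> x"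
proof -
  have lin: "linear \<phi>'" using assms has_derivative_linear by blast
  have "((\<lambda>t::real. x + t *\<^sub>R v) has_derivative (\<lambda>t. t *\<^sub>R v)) (at 0)"
    by (auto intro!: derivative_eq_intros)
  from diff_chain_at[OF this, of \<phi> \<phi>'] assms
  have "((\<lambda>t. \<phi> (x + t *\<^sub>R v)) has_derivative (\<lambda>t. \<phi>' (t *\<^sub>R v))) (at 0)" by (simp add: o_def)
  moreover have "(\<lambda>t. \<phi>' (t *\<^sub>R v)) = (*) (\<phi>' v)" using lin by (auto simp: linear_cmul mult.commute)
  ultimately have "((\<lambda>t. \<phi> (x + t *\<^sub>R v)) has_real_derivative \<phi>' v) (at 0)"
    unfolding has_field_derivative_def by simp
  then have lim: "((\<lambda>t. (\<phi> (x + t *\<^sub>R v) - \<phi> x) / t) \<longlongrightarrow> \<phi>' v) (at_right 0)"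
    unfolding DERIV_def using tendsto_mono[OF at_le[OF subset_UNIV]] by fastforce
  have pos: "\<forall>\<^sub>F t in at_right (0::real). t > 0" by (simp add: eventually_at_right_less)
  show "\<forall>\<^sub>F t in at_right 0. \<phi> (x + t *\<^sub>R v) < \<phi> x" if "\<phi>' v < 0"
    using order_tendstoD(2)[OF lim that] pos by eventually_elim (auto simp: field_simps)
  show "\<forall>\<^sub>F t in at_right 0. \<phi> (x + t *\<^sub>R v) > \<phi> x" if "\<phi>' v > 0"
    using order_tendstoD(1)[OF lim that] pos by eventually_elim (auto simp: field_simps)
qed

text \<open>If the unit vectors \<open>m\<close> and \<open>n\<close> given by two defining functions were different, then along
  \<open>n - m\<close> one of the functions would become negative and the other one positive, although their
  negativity sets are the same.\<close>

lemma outer_normal_eq: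
  fixes \<Omega> :: "'a::euclidean_space set"
  assumes \<phi>: "defining_function 1 \<Omega> U \<phi>" and "open \<Omega>" "x \<in> U" "x \<in> frontier \<Omega>"
  shows "outer_normal \<Omega> x = grad \<phi> x /\<^sub>R norm (grad \<phi> x)"
  unfolding outer_normal_def
proof (rule the_equality)
  show "\<exists>U \<phi>'. x \<in> U \<and> defining_function 1 \<Omega> U \<phi>' \<and>
      grad \<phi> x /\<^sub>R norm (grad \<phi> x) = grad \<phi>' x /\<^sub>R norm (grad \<phi>' x)" using assms by blast
next
  fix n assume "\<exists>V \<psi>. x \<in> V \<and> defining_function 1 \<Omega> V \<psi> \<and> n = grad \<psi> x /\<^sub>R norm (grad \<psi> x)"
  then obtain V \<psi> where V: "x \<in> V" "defining_function 1 \<Omega> V \<psi>" and n: "n = grad \<psi> x /\<^sub>R norm (grad \<psi> x)"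
    by blast
  define m where "m = grad \<phi> x /\<^sub>R norm (grad \<phi> x)"
  note df = defining_functionD[OF \<phi> order_refl] and dg = defining_functionD[OF V(2) order_refl]
  have nz: "grad \<phi> x \<noteq> 0" "grad \<psi> x \<noteq> 0" using df(4) dg(4) assms(3) V(1) by auto
  have unit: "m \<bullet> m = 1" "n \<bullet> n = 1" unfolding m_def n using nz
    by (auto simp: dot_square_norm power2_eq_square field_simps)
  show "n = m"
  proof (rule ccontr)
    assume "n \<noteq> m"
    then have "0 < (n - m) \<bullet> (n - m)" by (simp add: inner_gt_zero_iff)
    then have lt: "n \<bullet> m < 1" using unit by (simp add: inner_diff inner_commute algebra_simps)
    define v where "v = n - m"
    have "grad \<phi> x \<bullet> v = norm (grad \<phi> x) * (m \<bullet> v)" unfolding m_def using nz by simp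
    moreover have "m \<bullet> v < 0" using lt unit unfolding v_def by (simp add: inner_diff inner_commute)
    ultimately have "grad \<phi> x \<bullet> v < 0" using nz by (simp add: mult_pos_neg)
    then have 1: "\<forall>\<^sub>F t in at_right 0. \<phi> (x + t *\<^sub>R v) < \<phi> x"
      using has_derivative_sign(1)[OF df(3)[OF assms(3)]] by blast
    have "grad \<psi> x \<bullet> v = norm (grad \<psi> x) * (n \<bullet> v)" unfolding n using nz by simp
    moreover have "n \<bullet> v > 0" using lt unit unfolding v_def by (simp add: inner_diff inner_commute)
    ultimately have "grad \<psi> x \<bullet> v > 0" using nz by simp
    then have 2: "\<forall>\<^sub>F t in at_right 0. \<psi> (x + t *\<^sub>R v) > \<psi> x"
      using has_derivative_sign(2)[OF dg(3)[OF V(1)]] by blast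
    have "open (U \<inter> V)" "x \<in> U \<inter> V" using df(1) dg(1) assms(3) V(1) by auto
    moreover have "((\<lambda>t. x + t *\<^sub>R v) \<longlongrightarrow> x + 0 *\<^sub>R v) (at_right 0)"
      by (intro tendsto_intros)
    ultimately have 3: "\<forall>\<^sub>F t in at_right 0. x + t *\<^sub>R v \<in> U \<inter> V"
      using topological_tendstoD[of "\<lambda>t. x + t *\<^sub>R v" "x + 0 *\<^sub>R v" "at_right 0" "U \<inter> V"] by simp
    have "\<forall>\<^sub>F t in at_right (0::real). False"
      using 1 2 3
    proof eventually_elim
      case (elim t)
      then show False
        using df(5)[of "x + t *\<^sub>R v"] dg(5)[of "x + t *\<^sub>R v"]
          defining_function_zero[OF \<phi> assms(2-4)] defining_function_zero[OF V(2) assms(2) V(1) assms(4)] by auto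
    qed
    then show False by simp
  qed
qed

lemma Ck_on_1_grad:
  fixes \<phi> :: "'a::euclidean_space \<Rightarrow> real"
  assumes "Ck_on 2 \<phi> U" shows "Ck_on 1 (grad \<phi>) U"
proof -
  have C1: "Ck_on 1 (\<lambda>x. frechet_derivative \<phi> (at x) b) U" for b
    using assms by (simp add: numeral_2_eq_2)
  show ?thesis
  proof (rule Ck_on_1I)
    fix x assume "x \<in> U"
    then show "(grad \<phi> has_derivative (\<lambda>v. \<Sum>b\<in>Basis.
        frechet_derivative (\<lambda>x. frechet_derivative \<phi> (at x) b) (at x) v *\<^sub>R b)) (at x)"
      unfolding grad_def[abs_def] using Ck_on_1D(1)[OF C1]
      by (intro has_derivative_sum has_derivative_scaleR_left) auto
  next
    show "continuous_on U (\<lambda>x. \<Sum>b\<in>Basis.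
        frechet_derivative (\<lambda>x. frechet_derivative \<phi> (at x) b) (at x) v *\<^sub>R b)" for v
      using C1 by (intro continuous_intros) simp
  qed
qed

lemma has_derivative_norm_compose:
  fixes G :: "'a::real_normed_vector \<Rightarrow> 'b::real_inner"
  assumes "(G has_derivative G') (at x)" "G x \<noteq> 0"
  shows "((\<lambda>x. norm (G x)) has_derivative (\<lambda>h. G' h \<bullet> sgn (G x))) (at x)"
  using diff_chain_at[OF assms(1) has_derivative_norm[OF assms(2)]] by (simp add: o_def)

lemma Ck_on_1_normalize:
  fixes G :: "'a::euclidean_space \<Rightarrow> 'b::euclidean_space"
  assumes "Ck_on 1 G U" "\<And>x. x \<in> U \<Longrightarrow> G x \<noteq> 0"
  shows "Ck_on 1 (\<lambda>x. G x /\<^sub>R norm (G x)) U"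
proof (rule Ck_on_1I)
  fix x assume x: "x \<in> U"
  let ?D = "frechet_derivative G (at x)"
  show "((\<lambda>x. G x /\<^sub>R norm (G x)) has_derivative
     (\<lambda>v. inverse (norm (G x)) *\<^sub>R ?D v
       + (- (inverse (norm (G x)) * (?D v \<bullet> sgn (G x)) * inverse (norm (G x)))) *\<^sub>R G x)) (at x)"
    using Ck_on_1D(1)[OF assms(1) x] assms(2)[OF x]
    by (auto intro!: derivative_eq_intros has_derivative_norm_compose)
next
  fix v
  have c: "continuous_on U G" using Ck_on_antimono[OF assms(1), of 0] by simp
  have c': "continuous_on U (\<lambda>x. frechet_derivative G (at x) v)" using assms(1) by simp
  show "continuous_on U (\<lambda>x. inverse (norm (G x)) *\<^sub>R frechet_derivative G (at x) v
       + (- (inverse (norm (G x)) * (frechet_derivative G (at x) v \<bullet> sgn (G x)) * inverse (norm (G x)))) *\<^sub>R G x)"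
    using assms(2) unfolding sgn_div_norm by (intro continuous_intros c c') auto
qed

section \<open>Height functions\<close>

definition lift :: "real \<times> real \<Rightarrow> real \<Rightarrow> real^3" where
  "lift x z = fst x *\<^sub>R axis 1 1 + snd x *\<^sub>R axis 2 1 + z *\<^sub>R axis 3 1"

definition horiz :: "real^3 \<Rightarrow> real \<times> real" where
  "horiz y = (y $ 1, y $ 2)"

lemma lift_nth [simp]: "lift x z $ 1 = fst x" "lift x z $ 2 = snd x" "lift x z $ 3 = z"
  by (simp_all add: lift_def axis_def)

lemma horiz_lift [simp]: "horiz (lift x z) = x"
  by (simp add: horiz_def)

lemma lift_horiz [simp]: "lift (horiz y) (y $ 3) = y"
  by (simp add: vec_eq_iff forall_3 horiz_def)

lemma linear_horiz: "linear horiz"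
  by (rule linearI) (simp_all add: horiz_def)

lemma bounded_linear_horiz: "bounded_linear horiz"
  using linear_horiz by (rule linear_conv_bounded_linear[THEN iffD1])

lemma bounded_linear_lift: "bounded_linear (\<lambda>p. lift (fst p) (snd p))"
  unfolding linear_conv_bounded_linear[symmetric]
  by (rule linearI) (simp_all add: lift_def algebra_simps)

lemma lift_diff: "lift (x - y) (z - w) = lift x z - lift y w"
  by (simp add: lift_def algebra_simps)

lemma lift_decomp: "lift x z = lift x 0 + z *\<^sub>R axis 3 1"
  by (simp add: lift_def)

lemma sum_Basis_3: "(\<Sum>b\<in>(Basis::(real^3) set). F b) = F (axis 1 1) + F (axis 2 1) + F (axis 3 1)"
proof -
  have "(Basis::(real^3) set) = {axis 1 1, axis 2 1, axis 3 1}"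
    by (auto simp: Basis_vec_def UNIV_3)
  show ?thesis unfolding \<open>Basis = _\<close> by (simp add: axis_eq_axis add.assoc)
qed

lemma sum_Basis_2: "(\<Sum>b\<in>(Basis::(real \<times> real) set). F b) = F (1, 0) + F (0, 1)"
proof -
  have "(Basis::(real \<times> real) set) = {(1, 0), (0, 1)}" by (auto simp: Basis_prod_def)
  show ?thesis unfolding \<open>Basis = _\<close> by simp
qed

lemma inner_lift: "n \<bullet> lift x z = horiz n \<bullet> x + n $ 3 * z"
  by (simp add: inner_vec_def sum_3 horiz_def inner_prod_def)

lemma inner_eq_horiz: "(m::real^3) \<bullet> n = horiz m \<bullet> horiz n + m $ 3 * n $ 3"
  by (simp add: inner_vec_def sum_3 horiz_def inner_prod_def)

lemma norm_lift_0: "norm (lift x 0) = norm x"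
  by (simp add: norm_eq_sqrt_inner inner_lift horiz_def)

lemma norm_lift_le: "norm (lift x z) \<le> norm x + \<bar>z\<bar>"
proof -
  have "norm (lift x z) \<le> norm (lift x 0) + norm (z *\<^sub>R axis 3 1 :: real^3)"
    unfolding lift_decomp[of x z] by (rule norm_triangle_ineq)
  then show ?thesis by (simp add: norm_lift_0)
qed

lemma dist_lift_same: "dist (lift x z) (lift x w) = \<bar>z - w\<bar>"
proof -
  have "lift x z - lift x w = (z - w) *\<^sub>R axis 3 1" by (simp add: lift_def algebra_simps)
  then show ?thesis by (simp add: dist_norm)
qed

lemma continuous_on_lift [continuous_intros]:
  "continuous_on S f \<Longrightarrow> continuous_on S g \<Longrightarrow> continuous_on S (\<lambda>x. lift (f x) (g x))"
  unfolding lift_def by (intro continuous_intros)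

lemma continuous_on_horiz [continuous_intros]:
  "continuous_on S f \<Longrightarrow> continuous_on S (\<lambda>x. horiz (f x))"
  unfolding horiz_def by (intro continuous_intros)

lemma has_derivative_lift:
  assumes "(f has_derivative f') (at x within S)" "(g has_derivative g') (at x within S)"
  shows "((\<lambda>x. lift (f x) (g x)) has_derivative (\<lambda>v. lift (f' v) (g' v))) (at x within S)"
  using bounded_linear.has_derivative[OF bounded_linear_lift has_derivative_Pair[OF assms]] by simp

text \<open>The derivative in the implicit function theorem, for a continuous solution \<open>f\<close> that is already
  given. Differentiability of \<open>\<phi>\<close> gives \<open>c k + l = o(h + |k|)\<close>, where \<open>h\<close> is the size of the
  increment of \<open>x\<close>, \<open>k\<close> is the increment of \<open>f\<close>, and \<open>l\<close> and \<open>c\<close> are the horizontal and the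
  vertical derivative of \<open>\<phi>\<close>. As \<open>c\<close> is not zero, this first yields \<open>|k| \<le> A h\<close>; therefore the
  error is \<open>o(h)\<close>.\<close>

lemma implicit_height_has_derivative:
  fixes \<phi> :: "real^3 \<Rightarrow> real" and f :: "real \<times> real \<Rightarrow> real"
  assumes \<phi>: "(\<phi> has_derivative \<phi>') (at (lift y (f y)))"
    and f: "isCont f y" "\<forall>\<^sub>F x in nhds y. \<phi> (lift x (f x)) = \<phi> (lift y (f y))"
    and nz: "\<phi>' (axis 3 1) \<noteq> 0"
  shows "(f has_derivative (\<lambda>v. - (\<phi>' (lift v 0)) / \<phi>' (axis 3 1))) (at y)"
  unfolding has_derivative_at_alt
proof (intro conjI allI impI)
  let ?P = "lift y (f y)"
  define c where "c = \<phi>' (axis 3 1)"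
  have bl: "bounded_linear \<phi>'" using \<phi> by (rule has_derivative_bounded_linear)
  interpret \<phi>': bounded_linear \<phi>' by (rule bl)
  have "bounded_linear (\<lambda>v::real\<times>real. lift v 0)"
    using bounded_linear_compose[OF bounded_linear_lift, of "\<lambda>v. (v, 0)"]
    by (simp add: bounded_linear_Pair)
  then show "bounded_linear (\<lambda>v. - (\<phi>' (lift v 0)) / \<phi>' (axis 3 1))"
    using bounded_linear_compose[OF bl]
    by (intro bounded_linear_divide[THEN bounded_linear_compose] bounded_linear_minus) auto
  obtain B where B: "B > 0" "\<And>x. norm (\<phi>' x) \<le> norm x * B" using \<phi>'.pos_bounded by blast
  fix e :: real assume e: "e > 0"
  have c: "\<bar>c\<bar> > 0" using nz unfolding c_def by simp
  define A where "A = 2 * (B + \<bar>c\<bar>) / \<bar>c\<bar>"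
  have A: "A > 0" "\<bar>c\<bar> * A = 2 * (B + \<bar>c\<bar>)" using B c unfolding A_def by auto
  define \<epsilon> where "\<epsilon> = min (\<bar>c\<bar> / 2) (e * \<bar>c\<bar> / (1 + A))"
  have \<epsilon>: "\<epsilon> > 0" "\<epsilon> \<le> \<bar>c\<bar> / 2" "\<epsilon> * (1 + A) \<le> e * \<bar>c\<bar>"
  proof -
    show "\<epsilon> > 0" using c e A(1) unfolding \<epsilon>_def by auto
    show "\<epsilon> \<le> \<bar>c\<bar> / 2" unfolding \<epsilon>_def by (rule min.cobounded1)
    have "\<epsilon> \<le> e * \<bar>c\<bar> / (1 + A)" unfolding \<epsilon>_def by simp
    then show "\<epsilon> * (1 + A) \<le> e * \<bar>c\<bar>" using A(1) by (simp add: pos_le_divide_eq)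
  qed
  obtain \<delta> where \<delta>: "\<delta> > 0"
    "\<And>w. norm (w - ?P) < \<delta> \<Longrightarrow> norm (\<phi> w - \<phi> ?P - \<phi>' (w - ?P)) \<le> \<epsilon> * norm (w - ?P)"
    using \<phi> \<epsilon>(1) unfolding has_derivative_at_alt by meson
  have "((\<lambda>x. lift x (f x)) \<longlongrightarrow> ?P) (nhds y)"
    using f(1) unfolding lift_def isCont_def tendsto_at_iff_tendsto_nhds
    by (intro tendsto_intros) (auto intro: filterlim_ident)
  then have "\<forall>\<^sub>F x in nhds y. dist (lift x (f x)) ?P < \<delta>"
    using \<delta>(1) by (rule tendstoD)
  with f(2) have "\<forall>\<^sub>F x in nhds y. \<phi> (lift x (f x)) = \<phi> ?P \<and> dist (lift x (f x)) ?P < \<delta>"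
    by eventually_elim simp
  then obtain d where d: "d > 0"
    "\<And>x. dist x y < d \<Longrightarrow> \<phi> (lift x (f x)) = \<phi> ?P \<and> dist (lift x (f x)) ?P < \<delta>"
    unfolding eventually_nhds_metric by blast
  show "\<exists>d>0. \<forall>x. norm (x - y) < d \<longrightarrow>
      norm (f x - f y - - (\<phi>' (lift (x - y) 0)) / \<phi>' (axis 3 1)) \<le> e * norm (x - y)"
  proof (intro exI conjI allI impI)
    show "d > 0" by (rule d)
    fix x assume "norm (x - y) < d"
    then have x: "\<phi> (lift x (f x)) = \<phi> ?P" "norm (lift x (f x) - ?P) < \<delta>"
      using d(2)[of x] by (auto simp: dist_norm)
    define h where "h = norm (x - y)"
    define k where "k = f x - f y"
    define l where "l = \<phi>' (lift (x - y) 0)"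
    have h0: "h \<ge> 0" unfolding h_def by simp
    have eq: "lift x (f x) - ?P = lift (x - y) k" unfolding k_def by (simp add: lift_diff)
    have "\<phi>' (lift (x - y) k) = l + k * c"
      unfolding lift_decomp[of "x - y" k] \<phi>'.add \<phi>'.scaleR l_def c_def by simp
    then have "\<bar>l + k * c\<bar> \<le> \<epsilon> * norm (lift (x - y) k)"
      using \<delta>(2)[OF x(2)] x(1) unfolding eq by simp
    also have "\<dots> \<le> \<epsilon> * (h + \<bar>k\<bar>)"
      unfolding h_def using \<epsilon> norm_lift_le by (intro mult_left_mono) auto
    finally have 1: "\<bar>l + k * c\<bar> \<le> \<epsilon> * (h + \<bar>k\<bar>)" .
    have l: "\<bar>l\<bar> \<le> B * h" using B(2)[of "lift (x - y) 0"] unfolding l_def h_def norm_lift_0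
      by (simp add: mult.commute)
    have "\<bar>k\<bar> * \<bar>c\<bar> \<le> \<bar>l + k * c\<bar> + \<bar>l\<bar>" unfolding abs_mult[symmetric] by linarith
    also have "\<dots> \<le> \<epsilon> * (h + \<bar>k\<bar>) + B * h" using 1 l by linarith
    also have "\<dots> \<le> \<bar>c\<bar> / 2 * (h + \<bar>k\<bar>) + B * h"
      using \<epsilon>(2) h0 by (intro add_right_mono mult_right_mono) auto
    also have "\<dots> = (\<bar>c\<bar> * h) / 2 + (\<bar>k\<bar> * \<bar>c\<bar>) / 2 + B * h" by (simp add: field_simps)
    finally have "\<bar>k\<bar> * \<bar>c\<bar> \<le> 2 * (B * h) + 2 * (\<bar>c\<bar> * h)"
      using mult_nonneg_nonneg[OF less_imp_le[OF c] h0] by linarith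
    then have "\<bar>k\<bar> * \<bar>c\<bar> \<le> 2 * (B + \<bar>c\<bar>) * h" by (simp add: algebra_simps)
    then have "\<bar>c\<bar> * \<bar>k\<bar> \<le> \<bar>c\<bar> * (A * h)" using A(2) by (simp add: mult.assoc[symmetric] mult.commute)
    then have "\<bar>k\<bar> \<le> A * h" using c by (simp add: mult_le_cancel_left_pos)
    then have "\<epsilon> * (h + \<bar>k\<bar>) \<le> \<epsilon> * (h + A * h)" using \<epsilon> by (intro mult_left_mono) auto
    also have "\<dots> = \<epsilon> * (1 + A) * h" by (simp add: algebra_simps)
    also have "\<dots> \<le> e * \<bar>c\<bar> * h" using \<epsilon>(3) h0 by (rule mult_right_mono)
    finally have "\<bar>l + k * c\<bar> \<le> e * \<bar>c\<bar> * h" using 1 by linarith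
    moreover have "k - - l / c = (l + k * c) / c" using c by (simp add: field_simps)
    ultimately have "\<bar>k - - l / c\<bar> \<le> e * h" using c by (simp add: abs_divide divide_le_eq mult.commute mult.left_commute)
    then show "norm (f x - f y - - (\<phi>' (lift (x - y) 0)) / \<phi>' (axis 3 1)) \<le> e * norm (x - y)"
      unfolding k_def l_def c_def h_def by simp
  qed
qed

section \<open>The boundary of a strictly convex body\<close>

locale strictly_convex_body =
  fixes \<Omega> :: "(real^3) set"
  assumes open_\<Omega>: "open \<Omega>" and bounded_\<Omega>: "bounded \<Omega>"
    and strictly_convex_\<Omega>: "strictly_convex \<Omega>" and C2_boundary: "Ck_boundary 2 \<Omega>"
begin

abbreviation "N \<equiv> outer_normal \<Omega>"

lemma convex_\<Omega>: "convex \<Omega>"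
  unfolding convex_contains_open_segment
proof (intro ballI)
  fix x y assume "x \<in> \<Omega>" "y \<in> \<Omega>"
  then have "x \<in> closure \<Omega>" "y \<in> closure \<Omega>" using closure_subset by auto
  then show "open_segment x y \<subseteq> \<Omega>"
    using strictly_convex_\<Omega> interior_open[OF open_\<Omega>] unfolding strictly_convex_def
    by (cases "x = y") auto
qed

lemma frontier_iff: "x \<in> frontier \<Omega> \<longleftrightarrow> x \<in> closure \<Omega> \<and> x \<notin> \<Omega>"
  using open_\<Omega> by (simp add: frontier_def interior_open)

lemma compact_frontier_\<Omega>: "compact (frontier \<Omega>)"
  using bounded_\<Omega> by (rule compact_frontier_bounded)

lemma local_normal:
  assumes "x \<in> frontier \<Omega>"
  obtains U \<phi> where "open U" "x \<in> U" "defining_function 1 \<Omega> U \<phi>"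
    "Ck_on 1 (\<lambda>x. grad \<phi> x /\<^sub>R norm (grad \<phi> x)) U"
    "\<And>y. y \<in> U \<Longrightarrow> y \<in> frontier \<Omega> \<Longrightarrow> N y = grad \<phi> y /\<^sub>R norm (grad \<phi> y)"
proof -
  obtain U \<phi> where U: "x \<in> U" "defining_function 2 \<Omega> U \<phi>"
    using C2_boundary assms unfolding Ck_boundary_def by blast
  have one: "defining_function 1 \<Omega> U \<phi>" using defining_functionD(6)[OF U(2)] by simp
  have C2: "Ck_on 2 \<phi> U" using U(2) unfolding defining_function_def by blast
  have "Ck_on 1 (\<lambda>x. grad \<phi> x /\<^sub>R norm (grad \<phi> x)) U"
    using defining_functionD(4)[OF one] by (intro Ck_on_1_normalize Ck_on_1_grad[OF C2]) auto
  with that U(1) one defining_functionD(1)[OF one] outer_normal_eq[OF one open_\<Omega>] show thesis by blast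
qed

lemma norm_N: assumes "x \<in> frontier \<Omega>" shows "norm (N x) = 1"
proof -
  obtain U \<phi> where U: "open U" "x \<in> U" "defining_function 1 \<Omega> U \<phi>"
    "Ck_on 1 (\<lambda>x. grad \<phi> x /\<^sub>R norm (grad \<phi> x)) U"
    "\<And>y. y \<in> U \<Longrightarrow> y \<in> frontier \<Omega> \<Longrightarrow> N y = grad \<phi> y /\<^sub>R norm (grad \<phi> y)"
    by (rule local_normal[OF assms]) (rule that)
  have "grad \<phi> x \<noteq> 0" using defining_functionD(4)[OF U(3)] U(2) by auto
  then show ?thesis using U(5)[OF U(2) assms] by simp
qed

lemma continuous_on_N: "continuous_on (frontier \<Omega>) N"
  unfolding continuous_on_eq_continuous_within
proof
  fix x assume x: "x \<in> frontier \<Omega>"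
  obtain U \<phi> where U: "open U" "x \<in> U" "defining_function 1 \<Omega> U \<phi>"
    "Ck_on 1 (\<lambda>x. grad \<phi> x /\<^sub>R norm (grad \<phi> x)) U"
    "\<And>y. y \<in> U \<Longrightarrow> y \<in> frontier \<Omega> \<Longrightarrow> N y = grad \<phi> y /\<^sub>R norm (grad \<phi> y)"
    by (rule local_normal[OF x]) (rule that)
  obtain d where d: "d > 0" "ball x d \<subseteq> U" using U(1,2) open_contains_ball by blast
  have "((\<lambda>x. grad \<phi> x /\<^sub>R norm (grad \<phi> x)) has_derivative
      frechet_derivative (\<lambda>x. grad \<phi> x /\<^sub>R norm (grad \<phi> x)) (at x)) (at x)"
    using Ck_on_1D(1)[OF U(4,2)] .
  then have "continuous (at x within frontier \<Omega>) (\<lambda>x. grad \<phi> x /\<^sub>R norm (grad \<phi> x))"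
    using has_derivative_continuous continuous_at_imp_continuous_within by blast
  then show "continuous (at x within frontier \<Omega>) N"
  proof (rule continuous_transform_within[OF _ d(1) x])
    show "grad \<phi> y /\<^sub>R norm (grad \<phi> y) = N y" if "y \<in> frontier \<Omega>" "dist y x < d" for y
      using U(5)[of y] that d(2) by (auto simp: subset_iff dist_commute)
  qed
qed

text \<open>The segment from \<open>w\<close> to \<open>x\<close> lies in \<open>\<Omega>\<close>, so a defining function cannot increase from \<open>x\<close>
  towards \<open>w\<close>. The inequality is strict because it also holds at points slightly beyond \<open>w\<close> in the
  direction of the normal.\<close>

lemma supporting_plane:
  assumes x: "x \<in> frontier \<Omega>" and w: "w \<in> \<Omega>"
  shows "N x \<bullet> (w - x) < 0"
proof -
  obtain U \<phi> where U: "open U" "x \<in> U" "defining_function 1 \<Omega> U \<phi>"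
    "Ck_on 1 (\<lambda>x. grad \<phi> x /\<^sub>R norm (grad \<phi> x)) U"
    "\<And>y. y \<in> U \<Longrightarrow> y \<in> frontier \<Omega> \<Longrightarrow> N y = grad \<phi> y /\<^sub>R norm (grad \<phi> y)"
    by (rule local_normal[OF x]) (rule that)
  note df = defining_functionD[OF U(3) order_refl]
  have nz: "grad \<phi> x \<noteq> 0" using df(4) U(2) by auto
  have le: "N x \<bullet> (w - x) \<le> 0" if w: "w \<in> \<Omega>" for w
  proof (rule ccontr)
    assume "\<not> N x \<bullet> (w - x) \<le> 0"
    then have "0 < (grad \<phi> x \<bullet> (w - x)) / norm (grad \<phi> x)"
      using U(5)[OF U(2) x] by (simp add: divide_inverse mult.commute)
    then have "grad \<phi> x \<bullet> (w - x) > 0" using nz by (simp add: zero_less_divide_iff)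
    then have 1: "\<forall>\<^sub>F t in at_right 0. \<phi> (x + t *\<^sub>R (w - x)) > \<phi> x"
      using has_derivative_sign(2)[OF df(3)[OF U(2)]] by blast
    have "((\<lambda>t. x + t *\<^sub>R (w - x)) \<longlongrightarrow> x + 0 *\<^sub>R (w - x)) (at_right 0)"
      by (intro tendsto_intros)
    then have 2: "\<forall>\<^sub>F t in at_right 0. x + t *\<^sub>R (w - x) \<in> U"
      using topological_tendstoD[of "\<lambda>t. x + t *\<^sub>R (w - x)" "x + 0 *\<^sub>R (w - x)" "at_right 0" U] U(1,2) by simp
    have 3: "\<forall>\<^sub>F t in at_right (0::real). t \<in> {0<..<1}"
      by (rule eventually_at_right_real) simp
    have seg: "open_segment w x \<subseteq> \<Omega>"
      using in_interior_closure_convex_segment[OF convex_\<Omega>, of w x] w x open_\<Omega>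
      by (simp add: interior_open frontier_iff)
    have wx: "w \<noteq> x" using w x frontier_iff by auto
    have "\<forall>\<^sub>F t in at_right (0::real). False"
      using 1 2 3
    proof eventually_elim
      case (elim t)
      have "x + t *\<^sub>R (w - x) = (1 - (1 - t)) *\<^sub>R w + (1 - t) *\<^sub>R x" by (simp add: algebra_simps)
      then have "x + t *\<^sub>R (w - x) \<in> open_segment w x"
        unfolding in_segment using elim(3) wx by (intro conjI exI[of _ "1 - t"]) auto
      then have "\<phi> (x + t *\<^sub>R (w - x)) < 0" using seg df(5)[OF elim(2)] by blast
      then show False using elim(1) defining_function_zero[OF U(3) open_\<Omega> U(2) x] by simp
    qed
    then show False by simp
  qed
  obtain e where e: "e > 0" "ball w e \<subseteq> \<Omega>" using open_\<Omega> w open_contains_ball by blast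
  have "w + (e / 2) *\<^sub>R N x \<in> \<Omega>" using e norm_N[OF x] by (auto simp: subset_iff dist_norm)
  from le[OF this] have "N x \<bullet> (w - x) + e / 2 * (N x \<bullet> N x) \<le> 0"
    by (simp add: inner_diff inner_add algebra_simps)
  moreover have "N x \<bullet> N x = 1" using norm_N[OF x] by (simp add: dot_square_norm)
  ultimately show ?thesis using e by simp
qed

end

section \<open>Upper and lower boundary as graphs over the projection\<close>

definition shadow :: "(real^3) set \<Rightarrow> (real \<times> real) set" where
  "shadow \<Omega> = horiz ` \<Omega>"

definition upper :: "(real^3) set \<Rightarrow> real \<times> real \<Rightarrow> real" where
  "upper \<Omega> x = Sup {z. lift x z \<in> \<Omega>}"

definition lower :: "(real^3) set \<Rightarrow> real \<times> real \<Rightarrow> real" where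
  "lower \<Omega> x = Inf {z. lift x z \<in> \<Omega>}"

context strictly_convex_body
begin

abbreviation "D \<equiv> shadow \<Omega>"
abbreviation "up \<equiv> upper \<Omega>"
abbreviation "lo \<equiv> lower \<Omega>"

lemma mem_shadow_iff: "x \<in> D \<longleftrightarrow> (\<exists>z. lift x z \<in> \<Omega>)"
  unfolding shadow_def by (metis horiz_lift image_iff lift_horiz)

lemma open_shadow: "open D"
proof -
  have "surj horiz" using surjI[of horiz "\<lambda>x. lift x 0"] by simp
  then show ?thesis unfolding shadow_def
    using open_surjective_linear_image[OF open_\<Omega> linear_horiz] by blast
qed

lemma convex_shadow: "convex D"
  unfolding shadow_def using linear_horiz convex_\<Omega> by (rule convex_linear_image)

lemma bounded_shadow: "bounded D"
  unfolding shadow_def using bounded_\<Omega> bounded_linear_horiz by (rule bounded_linear_image)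

lemma section_open_bounded:
  "open {z. lift x z \<in> \<Omega>}" "bdd_above {z. lift x z \<in> \<Omega>}" "bdd_below {z. lift x z \<in> \<Omega>}"
proof -
  have "continuous_on UNIV (\<lambda>z. lift x z)" by (intro continuous_intros)
  then have "open ((\<lambda>z. lift x z) -` \<Omega>)" using open_\<Omega> by (intro open_vimage)
  moreover have "(\<lambda>z. lift x z) -` \<Omega> = {z. lift x z \<in> \<Omega>}" by auto
  ultimately show "open {z. lift x z \<in> \<Omega>}" by simp
  obtain B where B: "\<And>y. y \<in> \<Omega> \<Longrightarrow> norm y \<le> B" using bounded_\<Omega> unfolding bounded_iff by blast
  have "\<bar>z\<bar> \<le> B" if "lift x z \<in> \<Omega>" for z
    using B[OF that] component_le_norm_cart[of "lift x z" 3] by simp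
  then show "bdd_above {z. lift x z \<in> \<Omega>}" "bdd_below {z. lift x z \<in> \<Omega>}"
    by (auto simp: bdd_above_def bdd_below_def abs_le_iff) (metis minus_le_iff)
qed

lemma lift_between:
  assumes "lift x a \<in> \<Omega>" "lift x b \<in> closure \<Omega>" "a \<le> z \<and> z < b \<or> b < z \<and> z \<le> a"
  shows "lift x z \<in> \<Omega>"
proof (cases "z = a")
  case False
  have "b \<noteq> a" using assms(3) by auto
  define t where "t = (z - a) / (b - a)"
  have t: "0 < t" "t < 1" using assms(3) False unfolding t_def
    by (auto simp: zero_less_divide_iff divide_less_eq)
  have tz: "t * (b - a) = z - a" using \<open>b \<noteq> a\<close> unfolding t_def by simp
  have "lift x z = (1 - t) *\<^sub>R lift x a + t *\<^sub>R lift x b"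
    using tz by (simp add: vec_eq_iff forall_3 algebra_simps)
  moreover have "lift x a \<noteq> lift x b" using \<open>b \<noteq> a\<close> lift_nth(3) by metis
  ultimately have "lift x z \<in> open_segment (lift x a) (lift x b)" unfolding in_segment using t by auto
  then show ?thesis
    using in_interior_closure_convex_segment[OF convex_\<Omega>, of "lift x a" "lift x b"] assms(1,2) open_\<Omega>
    by (auto simp: interior_open)
qed (use assms in simp)

lemma lift_mem_iff:
  assumes "x \<in> D" shows "lift x z \<in> \<Omega> \<longleftrightarrow> lo x < z \<and> z < up x"
proof
  let ?S = "{z. lift x z \<in> \<Omega>}"
  assume "lift x z \<in> \<Omega>"
  then obtain e where e: "e > 0" "ball z e \<subseteq> ?S" using section_open_bounded(1)[of x] open_contains_ball by blast
  then have "z + e / 2 \<in> ?S" "z - e / 2 \<in> ?S" by (auto simp: subset_iff dist_real_def)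
  then have "z + e / 2 \<le> up x" "lo x \<le> z - e / 2" unfolding upper_def lower_def
    using cSup_upper[OF _ section_open_bounded(2)[of x]] cInf_lower[OF _ section_open_bounded(3)[of x]] by auto
  then show "lo x < z \<and> z < up x" using e by simp
next
  let ?S = "{z. lift x z \<in> \<Omega>}"
  assume z: "lo x < z \<and> z < up x"
  have ne: "?S \<noteq> {}" using assms mem_shadow_iff by auto
  obtain a where a: "a \<in> ?S" "a < z" using z cInf_less_iff[OF ne section_open_bounded(3)] unfolding lower_def by blast
  obtain b where b: "b \<in> ?S" "z < b" using z less_cSup_iff[OF ne section_open_bounded(2)] unfolding upper_def by blast
  show "lift x z \<in> \<Omega>" using lift_between[of x a b z] a b closure_subset by auto
qed

lemma lo_less_up: assumes "x \<in> D" shows "lo x < up x"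
  using assms lift_mem_iff[OF assms] mem_shadow_iff by (meson less_trans)

lemma lift_ends_closure:
  assumes "x \<in> D" shows "lift x (up x) \<in> closure \<Omega>" "lift x (lo x) \<in> closure \<Omega>"
proof -
  show "lift x (up x) \<in> closure \<Omega>"
    unfolding closure_approachable
  proof (intro allI impI)
    fix e :: real assume e: "e > 0"
    obtain z where z: "max (lo x) (up x - e) < z" "z < up x"
      using dense[of "max (lo x) (up x - e)" "up x"] e lo_less_up[OF assms] by auto
    then have "lift x z \<in> \<Omega>" using lift_mem_iff[OF assms] by simp
    moreover have "dist (lift x z) (lift x (up x)) < e" using z by (simp add: dist_lift_same)
    ultimately show "\<exists>y\<in>\<Omega>. dist y (lift x (up x)) < e" by blast
  qed
  show "lift x (lo x) \<in> closure \<Omega>"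
    unfolding closure_approachable
  proof (intro allI impI)
    fix e :: real assume e: "e > 0"
    obtain z where z: "lo x < z" "z < min (up x) (lo x + e)"
      using dense[of "lo x" "min (up x) (lo x + e)"] e lo_less_up[OF assms] by auto
    then have "lift x z \<in> \<Omega>" using lift_mem_iff[OF assms] by simp
    moreover have "dist (lift x z) (lift x (lo x)) < e" using z by (simp add: dist_lift_same)
    ultimately show "\<exists>y\<in>\<Omega>. dist y (lift x (lo x)) < e" by blast
  qed
qed

lemma lift_closure_iff:
  assumes "x \<in> D" shows "lift x z \<in> closure \<Omega> \<longleftrightarrow> lo x \<le> z \<and> z \<le> up x"
proof
  assume z: "lift x z \<in> closure \<Omega>"
  obtain a where a: "lift x a \<in> \<Omega>" using assms mem_shadow_iff by blast
  then have a': "lo x < a" "a < up x" using lift_mem_iff[OF assms] by auto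
  show "lo x \<le> z \<and> z \<le> up x"
  proof (rule ccontr)
    assume "\<not> (lo x \<le> z \<and> z \<le> up x)"
    then have "lift x (lo x) \<in> \<Omega> \<or> lift x (up x) \<in> \<Omega>"
      using lift_between[OF a z, of "lo x"] lift_between[OF a z, of "up x"] a' by auto
    then show False using lift_mem_iff[OF assms] by auto
  qed
next
  assume "lo x \<le> z \<and> z \<le> up x"
  then consider "z = lo x" | "z = up x" | "lo x < z \<and> z < up x" by force
  then show "lift x z \<in> closure \<Omega>"
    by cases (use lift_ends_closure[OF assms] lift_mem_iff[OF assms] closure_subset in auto)
qed

lemma lift_frontier_iff:
  assumes "x \<in> D" shows "lift x z \<in> frontier \<Omega> \<longleftrightarrow> z = lo x \<or> z = up x"
  unfolding frontier_iff lift_closure_iff[OF assms] lift_mem_iff[OF assms]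
  using lo_less_up[OF assms] by auto

lemma eventually_lift:
  assumes "open U" "lift y a \<in> U" shows "\<forall>\<^sub>F x in nhds y. lift x a \<in> U"
proof -
  have "((\<lambda>x. lift x a) \<longlongrightarrow> lift y a) (nhds y)"
    unfolding lift_def by (intro tendsto_intros) (auto intro: filterlim_ident)
  then show ?thesis using assms by (rule topological_tendstoD)
qed

text \<open>For a point \<open>y\<close> of \<open>D\<close> and a height \<open>a\<close>, being strictly between \<open>lo y\<close> and \<open>up y\<close> means that
  the point at height \<open>a\<close> is in the open set \<open>\<Omega>\<close>, and being strictly outside of this interval
  means that it is in the open complement of the closure. Both conditions persist near \<open>y\<close>.\<close>

lemma continuous_on_up: "continuous_on D up" and continuous_on_lo: "continuous_on D lo"
proof -
  have *: "isCont up y \<and> isCont lo y" if y: "y \<in> D" for y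
  proof -
    have evD: "\<forall>\<^sub>F x in nhds y. x \<in> D" using open_shadow y by (rule eventually_nhds_in_open)
    obtain m where m: "lift y m \<in> \<Omega>" using y mem_shadow_iff by blast
    have ev: "\<forall>\<^sub>F x in nhds y. lo x < a \<and> a < up x" if "lo y < a" "a < up y" for a
    proof -
      have "\<forall>\<^sub>F x in nhds y. lift x a \<in> \<Omega>"
        using that lift_mem_iff[OF y] by (intro eventually_lift[OF open_\<Omega>]) auto
      with evD show ?thesis by eventually_elim (simp add: lift_mem_iff)
    qed
    have ev': "\<forall>\<^sub>F x in nhds y. \<not> (lo x \<le> a \<and> a \<le> up x)" if "\<not> (lo y \<le> a \<and> a \<le> up y)" for a
    proof -
      have "\<forall>\<^sub>F x in nhds y. lift x a \<in> - closure \<Omega>"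
        using that lift_closure_iff[OF y] by (intro eventually_lift) auto
      with evD show ?thesis by eventually_elim (simp add: lift_closure_iff)
    qed
    have m': "lo y < m" "m < up y" using m lift_mem_iff[OF y] by auto
    note evm = ev[OF m']
    have "(up \<longlongrightarrow> up y) (nhds y)"
    proof (rule order_tendstoI)
      fix a assume "a < up y"
      then obtain b where "max a (lo y) < b" "b < up y" using dense[of "max a (lo y)" "up y"] m' by auto
      then show "\<forall>\<^sub>F x in nhds y. a < up x" using ev[of b] by (auto elim: eventually_mono)
    next
      fix a assume "up y < a"
      then have "\<forall>\<^sub>F x in nhds y. \<not> (lo x \<le> a \<and> a \<le> up x)" by (intro ev') auto
      with evm show "\<forall>\<^sub>F x in nhds y. up x < a"
      proof eventually_elim
        case (elim x)
        then show ?case using \<open>up y < a\<close> m' by auto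
      qed
    qed
    moreover have "(lo \<longlongrightarrow> lo y) (nhds y)"
    proof (rule order_tendstoI)
      fix a assume "lo y < a"
      then obtain b where "lo y < b" "b < min a (up y)" using dense[of "lo y" "min a (up y)"] m' by auto
      then show "\<forall>\<^sub>F x in nhds y. lo x < a" using ev[of b] by (auto elim: eventually_mono)
    next
      fix a assume "a < lo y"
      then have "\<forall>\<^sub>F x in nhds y. \<not> (lo x \<le> a \<and> a \<le> up x)" by (intro ev') auto
      with evm show "\<forall>\<^sub>F x in nhds y. a < lo x"
      proof eventually_elim
        case (elim x)
        then show ?case using \<open>a < lo y\<close> m' by auto
      qed
    qed
    ultimately show ?thesis unfolding isCont_def tendsto_at_iff_tendsto_nhds by simp
  qed
  then show "continuous_on D up" "continuous_on D lo"
    by (auto intro!: continuous_at_imp_continuous_on)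
qed

text \<open>The upper and the lower boundary are treated alike: a sheet is the height function of either.\<close>

definition sheet :: "(real \<times> real \<Rightarrow> real) \<Rightarrow> bool" where
  "sheet f \<longleftrightarrow> continuous_on D f \<and> (\<forall>x\<in>D. lift x (f x) \<in> frontier \<Omega>)"

lemma sheet_up: "sheet up" and sheet_lo: "sheet lo"
  using continuous_on_up continuous_on_lo lift_frontier_iff unfolding sheet_def by auto

abbreviation "normal_along f x \<equiv> N (lift x (f x))"

text \<open>The supporting planes at the two ends of a vertical chord leave the interior of the chord strictly
  on the inner side.\<close>

lemma normal_vertical_sign:
  assumes "x \<in> D" shows "normal_along up x $ 3 > 0" "normal_along lo x $ 3 < 0"
proof -
  obtain a where a: "lift x a \<in> \<Omega>" using assms mem_shadow_iff by blast
  then have a': "lo x < a" "a < up x" using lift_mem_iff[OF assms] by auto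
  have *: "N (lift x z) $ 3 * (a - z) < 0" if "lift x z \<in> frontier \<Omega>" for z
  proof -
    have "lift x a - lift x z = (a - z) *\<^sub>R axis 3 1" by (simp add: lift_def algebra_simps)
    then show ?thesis using supporting_plane[OF that a] by (simp add: inner_axis mult.commute)
  qed
  show "normal_along up x $ 3 > 0" using *[of "up x"] a' lift_frontier_iff[OF assms]
    by (simp add: mult_less_0_iff)
  show "normal_along lo x $ 3 < 0" using *[of "lo x"] a' lift_frontier_iff[OF assms]
    by (simp add: mult_less_0_iff)
qed

lemma sheet_normal_vertical_nonzero:
  assumes "sheet f" "x \<in> D" shows "normal_along f x $ 3 \<noteq> 0"
proof -
  have "lift x (f x) \<in> frontier \<Omega>" using assms unfolding sheet_def by blast
  then have "f x = lo x \<or> f x = up x" using lift_frontier_iff[OF assms(2)] by simp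
  then show ?thesis using normal_vertical_sign[OF assms(2)] by auto
qed

text \<open>This is the gradient of the height function \<open>f\<close> (\<open>sheet_has_derivative\<close>). Written in terms of
  the normal, it is visibly continuous and independent of any choice of a defining function.\<close>

definition slope :: "(real \<times> real \<Rightarrow> real) \<Rightarrow> real \<times> real \<Rightarrow> real \<times> real" where
  "slope f x = - (horiz (normal_along f x) /\<^sub>R (normal_along f x $ 3))"

lemma sheet_continuous_lift:
  assumes "sheet f" shows "continuous_on D (\<lambda>x. lift x (f x))"
  using assms unfolding sheet_def by (intro continuous_intros) auto

lemma sheet_continuous_normal:
  assumes "sheet f" shows "continuous_on D (normal_along f)"
  using assms unfolding sheet_def
  by (intro continuous_on_compose2[OF continuous_on_N sheet_continuous_lift[OF assms]]) auto

lemma sheet_continuous_slope: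
  assumes "sheet f" shows "continuous_on D (slope f)"
  unfolding slope_def using sheet_normal_vertical_nonzero[OF assms]
  by (intro continuous_intros continuous_on_horiz sheet_continuous_normal[OF assms]) auto

text \<open>Locally, a sheet is an implicit function given by a defining function. The vertical derivative of
  that function does not vanish because the normal is nowhere horizontal over \<open>D\<close>.\<close>

lemma sheet_has_derivative:
  assumes f: "sheet f" and x: "x \<in> D"
  shows "(f has_derivative (\<lambda>v. slope f x \<bullet> v)) (at x)"
proof -
  let ?P = "lift x (f x)"
  have fr: "lift y (f y) \<in> frontier \<Omega>" if "y \<in> D" for y using f that unfolding sheet_def by blast
  obtain U \<phi> where U: "open U" "?P \<in> U" "defining_function 1 \<Omega> U \<phi>"
    "Ck_on 1 (\<lambda>x. grad \<phi> x /\<^sub>R norm (grad \<phi> x)) U"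
    "\<And>y. y \<in> U \<Longrightarrow> y \<in> frontier \<Omega> \<Longrightarrow> N y = grad \<phi> y /\<^sub>R norm (grad \<phi> y)"
    by (rule local_normal[OF fr[OF x]]) (rule that)
  note df = defining_functionD[OF U(3) order_refl]
  let ?g = "grad \<phi> ?P"
  have g0: "?g \<noteq> 0" using df(4) U(2) by auto
  have N: "N ?P = ?g /\<^sub>R norm ?g" using U(5)[OF U(2) fr[OF x]] .
  have g3: "?g $ 3 \<noteq> 0" using sheet_normal_vertical_nonzero[OF f x] g0 unfolding N by simp
  have cont: "isCont f x" using f x open_shadow unfolding sheet_def by (simp add: continuous_on_eq_continuous_at)
  have "isCont (\<lambda>x. lift x (f x)) x"
    using sheet_continuous_lift[OF f] x open_shadow by (simp add: continuous_on_eq_continuous_at)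
  then have "((\<lambda>x. lift x (f x)) \<longlongrightarrow> ?P) (nhds x)"
    by (simp add: isCont_def tendsto_at_iff_tendsto_nhds[of "\<lambda>x. lift x (f x)"])
  then have "\<forall>\<^sub>F y in nhds x. lift y (f y) \<in> U" using U(1,2) by (rule topological_tendstoD)
  moreover have "\<forall>\<^sub>F y in nhds x. y \<in> D" using open_shadow x by (rule eventually_nhds_in_open)
  ultimately have "\<forall>\<^sub>F y in nhds x. \<phi> (lift y (f y)) = \<phi> ?P"
    by eventually_elim (use defining_function_zero[OF U(3) open_\<Omega>] fr x U(2) in metis)
  from implicit_height_has_derivative[OF df(3)[OF U(2)] cont this]
  have "(f has_derivative (\<lambda>v. - (?g \<bullet> lift v 0) / (?g \<bullet> axis 3 1))) (at x)"
    using g3 by (simp add: inner_axis)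
  moreover have "- (?g \<bullet> lift v 0) / (?g \<bullet> axis 3 1) = slope f x \<bullet> v" for v
    unfolding slope_def N using g0 g3
    by (simp add: inner_lift inner_axis horiz_def inner_prod_def field_simps)
  ultimately show ?thesis by simp
qed

lemma sheet_Ck_on_1_normal:
  assumes f: "sheet f" shows "Ck_on 1 (normal_along f) D"
proof (rule Ck_on_1_local)
  fix x assume x: "x \<in> D"
  let ?\<Phi> = "\<lambda>x. lift x (f x)"
  have fr: "lift y (f y) \<in> frontier \<Omega>" if "y \<in> D" for y using f that unfolding sheet_def by blast
  obtain U \<phi> where U: "open U" "?\<Phi> x \<in> U" "defining_function 1 \<Omega> U \<phi>"
    "Ck_on 1 (\<lambda>x. grad \<phi> x /\<^sub>R norm (grad \<phi> x)) U"
    "\<And>y. y \<in> U \<Longrightarrow> y \<in> frontier \<Omega> \<Longrightarrow> N y = grad \<phi> y /\<^sub>R norm (grad \<phi> y)"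
    by (rule local_normal[OF fr[OF x]]) (rule that)
  define V where "V = D \<inter> ?\<Phi> -` U"
  have V: "open V" "x \<in> V" "V \<subseteq> D"
    unfolding V_def using continuous_open_preimage[OF sheet_continuous_lift[OF f] open_shadow U(1)] x U(2) by auto
  have "Ck_on 1 ?\<Phi> D"
  proof (rule Ck_on_1I)
    show "(?\<Phi> has_derivative (\<lambda>v. lift v (slope f y \<bullet> v))) (at y)" if "y \<in> D" for y
      using has_derivative_lift[OF has_derivative_ident sheet_has_derivative[OF f that]] .
    show "continuous_on D (\<lambda>y. lift v (slope f y \<bullet> v))" for v
      by (intro continuous_intros sheet_continuous_slope[OF f])
  qed
  then have "Ck_on 1 ?\<Phi> V" using V(3) by (rule Ck_on_1_subset)
  from Ck_on_1_compose[OF U(4) this]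
  have "Ck_on 1 (\<lambda>y. grad \<phi> (?\<Phi> y) /\<^sub>R norm (grad \<phi> (?\<Phi> y))) V" unfolding V_def by auto
  moreover have "N (?\<Phi> y) = grad \<phi> (?\<Phi> y) /\<^sub>R norm (grad \<phi> (?\<Phi> y))" if "y \<in> V" for y
    using U(5)[of "?\<Phi> y"] fr that unfolding V_def by auto
  ultimately have "Ck_on 1 (normal_along f) V" by (rule Ck_on_1_cong[OF V(1), rotated])
  with V show "\<exists>V. open V \<and> x \<in> V \<and> Ck_on 1 (normal_along f) V" by blast
qed

abbreviation "dnormal f x \<equiv> frechet_derivative (normal_along f) (at x)"

text \<open>Let \<open>X'\<close> be any derivative of the normal within the boundary. On the tangent plane, spanned by
  \<open>e\<^sub>i + \<partial>\<^sub>i f e\<^sub>3\<close>, it is determined by the derivative \<open>K\<close> of the normal along the sheet. Its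
  values there are orthogonal to the normal \<open>n\<close>, as \<open>n\<close> has length 1. So \<open>X'\<close> restricts to an
  endomorphism of the tangent plane, whose trace is the mean curvature. The projection to the
  horizontal plane conjugates this endomorphism to the horizontal part of \<open>K\<close>, whose trace is the
  right-hand side.\<close>

lemma mean_curvature_sheet:
  assumes f: "sheet f" and x: "x \<in> D"
  shows "mean_curvature \<Omega> (lift x (f x)) = dnormal f x (1, 0) $ 1 + dnormal f x (0, 1) $ 2"
proof -
  let ?\<Phi> = "\<lambda>x. lift x (f x)"
  define P where "P = ?\<Phi> x"
  define n where "n = N P"
  define K where "K = dnormal f x"
  define s where "s = slope f x"
  have fr: "lift y (f y) \<in> frontier \<Omega>" if "y \<in> D" for y using f that unfolding sheet_def by blast
  have P: "P \<in> frontier \<Omega>" unfolding P_def using fr[OF x] .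
  obtain U \<phi> where U: "open U" "P \<in> U" "defining_function 1 \<Omega> U \<phi>"
    "Ck_on 1 (\<lambda>x. grad \<phi> x /\<^sub>R norm (grad \<phi> x)) U"
    "\<And>y. y \<in> U \<Longrightarrow> y \<in> frontier \<Omega> \<Longrightarrow> N y = grad \<phi> y /\<^sub>R norm (grad \<phi> y)"
    by (rule local_normal[OF P]) (rule that)
  have n3: "n $ 3 \<noteq> 0" unfolding n_def P_def by (rule sheet_normal_vertical_nonzero[OF f x])
  have K: "(normal_along f has_derivative K) (at x)"
    unfolding K_def by (rule Ck_on_1D(1)[OF sheet_Ck_on_1_normal[OF f] x])
  have \<Phi>: "(?\<Phi> has_derivative (\<lambda>v. lift v (s \<bullet> v))) (at x)"
    unfolding s_def by (rule has_derivative_lift[OF has_derivative_ident sheet_has_derivative[OF f x]])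
  have nK: "n \<bullet> K v = 0" for v
  proof -
    have "((\<lambda>y. normal_along f y \<bullet> normal_along f y) has_derivative
        (\<lambda>v. normal_along f x \<bullet> K v + K v \<bullet> normal_along f x)) (at x)"
      by (rule has_derivative_inner[OF K K])
    moreover have "((\<lambda>y. normal_along f y \<bullet> normal_along f y) has_derivative (\<lambda>v. 0)) (at x)"
    proof (rule has_derivative_transform_within_open[OF has_derivative_const open_shadow x])
      show "1 = normal_along f y \<bullet> normal_along f y" if "y \<in> D" for y
        using norm_N[OF fr[OF that]] by (simp add: dot_square_norm)
    qed
    ultimately have "(\<lambda>v. normal_along f x \<bullet> K v + K v \<bullet> normal_along f x) = (\<lambda>v. 0)"
      by (rule has_derivative_unique)
    then have "normal_along f x \<bullet> K v + K v \<bullet> normal_along f x = 0" by (rule fun_cong)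
    then show ?thesis unfolding n_def P_def by (simp add: inner_commute)
  qed
  have nn: "n $ 1 * n $ 1 + n $ 2 * n $ 2 + n $ 3 * n $ 3 = 1"
    using norm_N[OF P] unfolding n_def norm_eq_1 by (simp add: inner_vec_def sum_3)
  have s: "fst s = - n $ 1 / n $ 3" "snd s = - n $ 2 / n $ 3"
    unfolding s_def slope_def n_def P_def horiz_def by (simp_all add: divide_inverse mult.commute)
  have trace: "(\<Sum>b\<in>Basis. X' b \<bullet> b) - X' n \<bullet> n = K (1, 0) $ 1 + K (0, 1) $ 2"
    if X': "(N has_derivative X') (at P within frontier \<Omega>)" for X'
  proof -
    have "(N has_derivative X') (at (?\<Phi> x) within ?\<Phi> ` D)"
      using X' unfolding P_def by (rule has_derivative_subset) (use fr in auto)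
    from diff_chain_within[OF has_derivative_at_withinI[OF \<Phi>] this]
    have "((N \<circ> ?\<Phi>) has_derivative (X' \<circ> (\<lambda>v. lift v (s \<bullet> v)))) (at x)"
      unfolding at_within_open[OF x open_shadow] .
    then have "(normal_along f has_derivative (\<lambda>v. X' (lift v (s \<bullet> v)))) (at x)" by (simp add: o_def)
    then have KX: "K = (\<lambda>v. X' (lift v (s \<bullet> v)))" using K has_derivative_unique by blast
    have lin: "linear X'" using X' by (rule has_derivative_linear)
    \<comment> \<open>\<open>w\<close> depends on the choice of \<open>X'\<close>; it enters the full trace and the normal part of the trace
      with the same coefficient and cancels.\<close>
    define w where "w = X' (axis 3 1)"
    have e1: "X' (axis 1 1) = K (1, 0) - fst s *\<^sub>R w"
      unfolding KX w_def lift_def by (simp add: linear_add[OF lin] linear_cmul[OF lin] inner_prod_def)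
    have e2: "X' (axis 2 1) = K (0, 1) - snd s *\<^sub>R w"
      unfolding KX w_def lift_def by (simp add: linear_add[OF lin] linear_cmul[OF lin] inner_prod_def)
    have "n = n $ 1 *\<^sub>R axis 1 1 + n $ 2 *\<^sub>R axis 2 1 + n $ 3 *\<^sub>R axis 3 1"
      by (simp add: vec_eq_iff forall_3 axis_def)
    then have "X' n = X' (n $ 1 *\<^sub>R axis 1 1 + n $ 2 *\<^sub>R axis 2 1 + n $ 3 *\<^sub>R axis 3 1)" by simp
    also have "\<dots> = n $ 1 *\<^sub>R X' (axis 1 1) + n $ 2 *\<^sub>R X' (axis 2 1) + n $ 3 *\<^sub>R w"
      unfolding w_def by (simp add: linear_add[OF lin] linear_cmul[OF lin])
    also have "\<dots> = n $ 1 *\<^sub>R K (1, 0) + n $ 2 *\<^sub>R K (0, 1) + (n $ 3 - n $ 1 * fst s - n $ 2 * snd s) *\<^sub>R w"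
      unfolding e1 e2 by (simp add: algebra_simps)
    also have "n $ 3 - n $ 1 * fst s - n $ 2 * snd s = 1 / n $ 3"
      unfolding s using nn n3 by (simp add: field_simps)
    finally have Xn: "X' n \<bullet> n = (w \<bullet> n) / n $ 3"
      using nK[of "(1,0)"] nK[of "(0,1)"]
      by (simp add: inner_commute[of _ n] inner_add_right)
    have "w \<bullet> n = w $ 1 * n $ 1 + w $ 2 * n $ 2 + w $ 3 * n $ 3" by (simp add: inner_vec_def sum_3)
    then have "w $ 3 - fst s * w $ 1 - snd s * w $ 2 = (w \<bullet> n) / n $ 3"
      unfolding s using n3 by (simp add: field_simps)
    moreover have "(\<Sum>b\<in>Basis. X' b \<bullet> b) = K (1, 0) $ 1 - fst s * w $ 1 + (K (0, 1) $ 2 - snd s * w $ 2) + w $ 3"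
      unfolding sum_Basis_3 e1 e2 w_def[symmetric] by (simp add: inner_axis)
    ultimately show ?thesis unfolding Xn by linarith
  qed
  obtain d where d: "d > 0" "ball P d \<subseteq> U" using U(1,2) open_contains_ball by blast
  have "(N has_derivative frechet_derivative (\<lambda>x. grad \<phi> x /\<^sub>R norm (grad \<phi> x)) (at P)) (at P within frontier \<Omega>)"
  proof (rule has_derivative_transform_within[OF has_derivative_at_withinI[OF Ck_on_1D(1)[OF U(4,2)]] d(1) P])
    show "grad \<phi> y /\<^sub>R norm (grad \<phi> y) = N y" if "y \<in> frontier \<Omega>" "dist y P < d" for y
      using U(5)[of y] that d(2) by (auto simp: subset_iff dist_commute)
  qed
  then have "tangential_divergence (frontier \<Omega>) n N P = K (1, 0) $ 1 + K (0, 1) $ 2"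
    unfolding tangential_divergence_def
  proof (intro the_equality)
    fix e assume "\<exists>X'. (N has_derivative X') (at P within frontier \<Omega>) \<and> e = (\<Sum>b\<in>Basis. X' b \<bullet> b) - X' n \<bullet> n"
    then show "e = K (1, 0) $ 1 + K (0, 1) $ 2" using trace by blast
  qed (use trace in auto)
  then show ?thesis unfolding mean_curvature_def n_def P_def K_def .
qed

end

section \<open>Comparing the upper with the lower boundary\<close>

text \<open>With \<open>q = a / s\<close> one has \<open>a = q / sqrt (1 + |q|\<^sup>2)\<close>. So this is a quantitative form of the strict
  monotonicity of the nonlinearity in the mean curvature equation for graphs.\<close>

lemma unit_graph_normals_monotone:
  fixes a b :: "'a::real_inner" and s t :: real
  assumes "a \<bullet> a + s * s = 1" "b \<bullet> b + t * t = 1" "s > 0" "t > 0"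
  shows "(a /\<^sub>R s - b /\<^sub>R t) \<bullet> (a - b) = (1 / s + 1 / t) * (((a - b) \<bullet> (a - b) + (s - t)\<^sup>2) / 2)"
proof -
  define c where "c = a \<bullet> b"
  have a: "a \<bullet> a = 1 - s * s" and b: "b \<bullet> b = 1 - t * t" using assms(1,2) by (auto simp: algebra_simps)
  have c': "b \<bullet> a = c" unfolding c_def by (rule inner_commute)
  have "(a /\<^sub>R s - b /\<^sub>R t) \<bullet> (a - b) = (1 - s * s) / s - c / s - c / t + (1 - t * t) / t"
    by (simp add: inner_diff a b c' c_def[symmetric] divide_inverse algebra_simps)
  also have "\<dots> = (1 / s + 1 / t) * (1 - c - s * t)"
    using assms by (simp add: field_simps)
  also have "1 - c - s * t = ((a - b) \<bullet> (a - b) + (s - t)\<^sup>2) / 2"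
    by (simp add: inner_diff a b c' c_def[symmetric] power2_eq_square algebra_simps)
  finally show ?thesis .
qed

context strictly_convex_body
begin

text \<open>The pairs of points of the closure on a common vertical line at distance at least \<open>\<delta>\<close> form
  a compact set. The midpoint of such a pair lies in \<open>\<Omega>\<close> by strict convexity, so these pairs
  project to a compact subset of \<open>D\<close>.\<close>

lemma thickness_small_off_compact:
  assumes "\<delta> > 0"
  obtains K where "compact K" "K \<subseteq> D" "\<And>x. x \<in> D \<Longrightarrow> x \<notin> K \<Longrightarrow> up x - lo x < \<delta>"
proof -
  define T where "T = {p \<in> closure \<Omega> \<times> closure \<Omega>. horiz (fst p) = horiz (snd p) \<and> \<delta> \<le> dist (fst p) (snd p)}"
  have "closed ({p. horiz (fst p) = horiz (snd p)} \<inter> {p. \<delta> \<le> dist (fst p) (snd p)})"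
    by (intro closed_Int closed_Collect_eq closed_Collect_le continuous_intros)
  moreover have "compact (closure \<Omega> \<times> closure \<Omega>)"
    using bounded_\<Omega> by (intro compact_Times) (auto simp: compact_closure)
  moreover have "T = (closure \<Omega> \<times> closure \<Omega>) \<inter> ({p. horiz (fst p) = horiz (snd p)} \<inter> {p. \<delta> \<le> dist (fst p) (snd p)})"
    unfolding T_def by auto
  ultimately have "compact T" by (simp add: compact_Int_closed)
  then have "compact ((\<lambda>p. horiz (fst p)) ` T)"
    by (intro compact_continuous_image continuous_intros)
  moreover have "(\<lambda>p. horiz (fst p)) ` T \<subseteq> D"
  proof
    fix x assume "x \<in> (\<lambda>p. horiz (fst p)) ` T"
    then obtain v w where vw: "v \<in> closure \<Omega>" "w \<in> closure \<Omega>" "horiz v = x" "horiz w = x" "\<delta> \<le> dist v w"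
      unfolding T_def by auto
    then have "v \<noteq> w" using assms by auto
    then have "midpoint v w \<in> \<Omega>"
      using strictly_convex_\<Omega> vw(1,2) open_\<Omega> unfolding strictly_convex_def
      by (metis interior_open midpoint_in_open_segment subset_eq)
    moreover have "horiz (midpoint v w) = x"
      using vw(3,4) by (auto simp: midpoint_def horiz_def)
    ultimately show "x \<in> D" unfolding shadow_def by blast
  qed
  moreover have "up x - lo x < \<delta>" if "x \<in> D" "x \<notin> (\<lambda>p. horiz (fst p)) ` T" for x
  proof (rule ccontr)
    assume "\<not> up x - lo x < \<delta>"
    then have "(lift x (up x), lift x (lo x)) \<in> T"
      using lift_ends_closure[OF that(1)] unfolding T_def by (simp add: dist_lift_same)
    then have "horiz (lift x (up x)) \<in> (\<lambda>p. horiz (fst p)) ` T" by force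
    then show False using that(2) by simp
  qed
  ultimately show thesis by (rule that)
qed

text \<open>This is the field \<open>X\<close> of the introduction: the normals of \<open>up\<close> and \<open>lo\<close> have the horizontal
  parts \<open>- \<nabla>up / sqrt (1 + |\<nabla>up|\<^sup>2)\<close> and \<open>\<nabla>lo / sqrt (1 + |\<nabla>lo|\<^sup>2)\<close>.\<close>

definition tilt_gap :: "real \<times> real \<Rightarrow> real \<times> real" where
  "tilt_gap x = horiz (normal_along up x) - horiz (normal_along lo x)"

text \<open>Near the boundary of \<open>D\<close>, the two ends of a vertical chord are close to each other, and so are the
  normals there, by uniform continuity on the compact boundary of \<open>\<Omega>\<close>.\<close>

lemma continuous_weighted_tilt_gap:
  assumes q: "continuous_on D q" and B: "\<And>x. x \<in> D \<Longrightarrow> \<bar>q x\<bar> \<le> B"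
  shows "continuous_on UNIV (\<lambda>x. if x \<in> D then q x *\<^sub>R tilt_gap x else 0)"
proof (rule continuous_at_imp_continuous_on, rule ballI)
  let ?Y = "\<lambda>x. if x \<in> D then q x *\<^sub>R tilt_gap x else 0"
  fix y :: "real \<times> real"
  show "isCont ?Y y"
  proof (cases "y \<in> D")
    case True
    have "continuous_on D (\<lambda>x. q x *\<^sub>R tilt_gap x)"
      unfolding tilt_gap_def
      by (intro continuous_intros q sheet_continuous_normal sheet_up sheet_lo)
    then have "continuous_on D ?Y" by (rule continuous_on_eq) simp
    then show ?thesis using True open_shadow continuous_on_eq_continuous_at by blast
  next
    case False
    have "(?Y \<longlongrightarrow> 0) (nhds y)"
    proof (rule tendstoI)
      fix e :: real assume e: "e > 0"
      define c where "c = \<bar>B\<bar> + 1"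
      have c: "c > 0" unfolding c_def by simp
      have "uniformly_continuous_on (frontier \<Omega>) N"
        using continuous_on_N compact_frontier_\<Omega> by (rule compact_uniformly_continuous)
      then obtain \<delta> where \<delta>: "\<delta> > 0"
        "\<And>v w. v \<in> frontier \<Omega> \<Longrightarrow> w \<in> frontier \<Omega> \<Longrightarrow> dist v w < \<delta> \<Longrightarrow> dist (N v) (N w) < e / c"
        unfolding uniformly_continuous_on_def using divide_pos_pos[OF e c] by blast
      obtain K where K: "compact K" "K \<subseteq> D" "\<And>x. x \<in> D \<Longrightarrow> x \<notin> K \<Longrightarrow> up x - lo x < \<delta>"
        by (rule thickness_small_off_compact[OF \<delta>(1)]) (rule that)
      have "open (- K)" using K(1) compact_imp_closed by auto
      then have "\<forall>\<^sub>F x in nhds y. x \<in> - K" using K(2) False by (intro eventually_nhds_in_open) auto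
      then show "\<forall>\<^sub>F x in nhds y. dist (?Y x) 0 < e"
      proof eventually_elim
        case (elim x)
        show ?case
        proof (cases "x \<in> D")
          case True
          let ?n = "normal_along up x" and ?m = "normal_along lo x"
          have "up x - lo x < \<delta>" using K(3)[OF True] elim by simp
          then have "dist (lift x (up x)) (lift x (lo x)) < \<delta>"
            using lo_less_up[OF True] by (simp add: dist_lift_same)
          then have d: "norm (?n - ?m) < e / c"
            using \<delta>(2) lift_frontier_iff[OF True] by (auto simp: dist_norm)
          have "tilt_gap x = horiz (?n - ?m)" unfolding tilt_gap_def horiz_def by simp
          moreover have "norm (horiz v) \<le> norm v" for v :: "real^3"
            using inner_eq_horiz[of v v] unfolding norm_eq_sqrt_inner by simp
          ultimately have t: "norm (tilt_gap x) < e / c" using d by (metis le_less_trans)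
          have "norm (?Y x) = \<bar>q x\<bar> * norm (tilt_gap x)" using True by simp
          also have "\<dots> \<le> c * norm (tilt_gap x)"
            using B[OF True] unfolding c_def by (intro mult_right_mono) auto
          also have "\<dots> < c * (e / c)" using t c by (intro mult_strict_left_mono)
          finally show ?thesis using c by simp
        qed (use e in simp)
      qed
    qed
    then have "(?Y \<longlongrightarrow> 0) (at y)" by (rule tendsto_mono[OF at_within_le_nhds])
    then show ?thesis using False unfolding isCont_def by simp
  qed
qed

definition curvature_gap :: "real \<times> real \<Rightarrow> real" where
  "curvature_gap x = mean_curvature \<Omega> (lift x (up x)) - mean_curvature \<Omega> (lift x (lo x))"

text \<open>The divergence of \<open>q *\<^sub>R tilt_gap\<close> is \<open>q * curvature_gap + \<nabla>q \<bullet> tilt_gap\<close>, where \<open>r = \<nabla>q\<close>.\<close>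

lemma nonneg_weighted_divergence_eq_0:
  assumes q: "\<And>x. x \<in> D \<Longrightarrow> (q has_derivative (\<lambda>v. r x \<bullet> v)) (at x)"
    and r: "continuous_on D r" and B: "\<And>x. x \<in> D \<Longrightarrow> \<bar>q x\<bar> \<le> B"
    and nonneg: "\<And>x. x \<in> D \<Longrightarrow> 0 \<le> q x * curvature_gap x + r x \<bullet> tilt_gap x"
    and x: "x \<in> D"
  shows "q x * curvature_gap x + r x \<bullet> tilt_gap x = 0"
proof -
  let ?Y = "\<lambda>x. if x \<in> D then q x *\<^sub>R tilt_gap x else 0"
  define T where "T x v = horiz (dnormal up x v) - horiz (dnormal lo x v)" for x v
  define d where "d b x = q x * (T x b \<bullet> b) + (r x \<bullet> b) * (tilt_gap x \<bullet> b)" for b x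
  have T: "(tilt_gap has_derivative T x) (at x)" if "x \<in> D" for x
    unfolding T_def tilt_gap_def[abs_def]
    by (intro has_derivative_diff bounded_linear.has_derivative[OF bounded_linear_horiz]
        Ck_on_1D(1)[OF sheet_Ck_on_1_normal that] sheet_up sheet_lo)
  have cq: "continuous_on D q"
    using q has_derivative_continuous by (blast intro: continuous_at_imp_continuous_on)
  have ctilt: "continuous_on D tilt_gap"
    using T has_derivative_continuous by (blast intro: continuous_at_imp_continuous_on)
  have div: "(\<Sum>b\<in>Basis. d b x) = q x * curvature_gap x + r x \<bullet> tilt_gap x" if "x \<in> D" for x
  proof -
    have "(\<Sum>b\<in>Basis. T x b \<bullet> b) = curvature_gap x"
      unfolding curvature_gap_def mean_curvature_sheet[OF sheet_up that] mean_curvature_sheet[OF sheet_lo that]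
        sum_Basis_2 T_def by (simp add: horiz_def inner_prod_def)
    moreover have "(\<Sum>b\<in>Basis. (r x \<bullet> b) * (tilt_gap x \<bullet> b)) = r x \<bullet> tilt_gap x"
      by (rule euclidean_inner[symmetric])
    ultimately show ?thesis unfolding d_def by (simp add: sum.distrib sum_distrib_left[symmetric])
  qed
  have "(\<Sum>b\<in>Basis. d b x) = 0"
  proof (rule nonneg_divergence_eq_0[OF open_shadow convex_shadow bounded_shadow, of ?Y d])
    show "continuous_on UNIV ?Y" using cq B by (rule continuous_weighted_tilt_gap)
    show "?Y x = 0" if "x \<notin> D" for x using that by simp
    show "continuous_on D (d b)" for b
    proof -
      have "continuous_on D (\<lambda>x. T x b)"
        unfolding T_def
        by (intro continuous_intros Ck_on_1D(2)[OF sheet_Ck_on_1_normal] sheet_up sheet_lo)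
      then show ?thesis unfolding d_def[abs_def] by (intro continuous_intros cq r ctilt)
    qed
    show "((\<lambda>s. ?Y (x + s *\<^sub>R b) \<bullet> b) has_real_derivative d b x) (at 0)" if x: "x \<in> D" for b x
    proof -
      have "((\<lambda>x. q x *\<^sub>R tilt_gap x) has_derivative (\<lambda>v. q x *\<^sub>R T x v + (r x \<bullet> v) *\<^sub>R tilt_gap x)) (at x)"
        by (rule has_derivative_scaleR[OF q[OF x] T[OF x]])
      then have "(?Y has_derivative (\<lambda>v. q x *\<^sub>R T x v + (r x \<bullet> v) *\<^sub>R tilt_gap x)) (at x)"
        by (rule has_derivative_transform_within_open[OF _ open_shadow x]) simp
      from has_derivative_imp_directional[OF this, of b b]
      show ?thesis unfolding d_def by (simp add: inner_add_left)
    qed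
    show "0 \<le> (\<Sum>b\<in>Basis. d b x)" if "x \<in> D" for x using div[OF that] nonneg[OF that] by simp
    show "x \<in> D" by (rule x)
  qed
  then show ?thesis using div[OF x] by simp
qed

lemma slope_sum_tilt_gap:
  assumes x: "x \<in> D"
  shows "(slope up x + slope lo x) \<bullet> tilt_gap x \<le> 0"
    and "(slope up x + slope lo x) \<bullet> tilt_gap x = 0 \<Longrightarrow> slope up x + slope lo x = 0"
proof -
  define a where "a = horiz (normal_along up x)"
  define b where "b = horiz (normal_along lo x)"
  define s where "s = normal_along up x $ 3"
  define t where "t = - (normal_along lo x $ 3)"
  have st: "s > 0" "t > 0" using normal_vertical_sign[OF x] unfolding s_def t_def by auto
  have "normal_along up x \<bullet> normal_along up x = 1" "normal_along lo x \<bullet> normal_along lo x = 1"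
    using norm_N lift_frontier_iff[OF x] by (auto simp: dot_square_norm)
  then have unit: "a \<bullet> a + s * s = 1" "b \<bullet> b + t * t = 1"
    unfolding inner_eq_horiz a_def b_def s_def t_def by auto
  have sl: "slope up x + slope lo x = - (a /\<^sub>R s - b /\<^sub>R t)"
    unfolding slope_def a_def b_def s_def t_def by simp
  have "(slope up x + slope lo x) \<bullet> tilt_gap x = - ((a /\<^sub>R s - b /\<^sub>R t) \<bullet> (a - b))"
    unfolding sl tilt_gap_def a_def b_def by (rule inner_minus_left)
  also have "\<dots> = - ((1 / s + 1 / t) * (((a - b) \<bullet> (a - b) + (s - t)\<^sup>2) / 2))"
    unfolding unit_graph_normals_monotone[OF unit st] ..
  finally have eq: "(slope up x + slope lo x) \<bullet> tilt_gap x
      = - ((1 / s + 1 / t) * (((a - b) \<bullet> (a - b) + (s - t)\<^sup>2) / 2))" .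
  have c: "1 / s + 1 / t > 0" using st by (simp add: add_pos_pos)
  show "(slope up x + slope lo x) \<bullet> tilt_gap x \<le> 0" unfolding eq using c by simp
  assume "(slope up x + slope lo x) \<bullet> tilt_gap x = 0"
  then have "(a - b) \<bullet> (a - b) + (s - t)\<^sup>2 = 0" unfolding eq using c by simp
  then have "(a - b) \<bullet> (a - b) = 0" "(s - t)\<^sup>2 = 0"
    by (simp_all add: add_nonneg_eq_0_iff)
  then show "slope up x + slope lo x = 0" unfolding sl by simp
qed

text \<open>A constant weight \<open>q\<close> shows that the curvature gap vanishes; then the weight \<open>- (up + lo)\<close> shows
  that the gradient of \<open>up + lo\<close> vanishes.\<close>

theorem midheight_constant:
  assumes sign: "(\<forall>x\<in>D. 0 \<le> curvature_gap x) \<or> (\<forall>x\<in>D. curvature_gap x \<le> 0)"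
  shows "\<exists>l. \<forall>x\<in>D. up x + lo x = 2 * l"
proof -
  have gap0: "curvature_gap x = 0" if x: "x \<in> D" for x
  proof -
    define \<epsilon> :: real where "\<epsilon> = (if \<forall>x\<in>D. 0 \<le> curvature_gap x then 1 else - 1)"
    have "\<epsilon> * curvature_gap x + 0 \<bullet> tilt_gap x = 0"
    proof (rule nonneg_weighted_divergence_eq_0[where q = "\<lambda>_. \<epsilon>" and r = "\<lambda>_. 0" and B = 1])
      show "((\<lambda>_. \<epsilon>) has_derivative (\<lambda>v. 0 \<bullet> v)) (at y)" for y :: "real \<times> real" by simp
      show "\<bar>\<epsilon>\<bar> \<le> 1" unfolding \<epsilon>_def by simp
      show "0 \<le> \<epsilon> * curvature_gap y + 0 \<bullet> tilt_gap y" if "y \<in> D" for y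
        using sign that unfolding \<epsilon>_def by auto
    qed (use x in auto)
    then show ?thesis unfolding \<epsilon>_def by (simp split: if_splits)
  qed
  obtain B where B: "\<And>y. y \<in> closure \<Omega> \<Longrightarrow> norm y \<le> B"
    using bounded_closure[OF bounded_\<Omega>] unfolding bounded_iff by blast
  have end_le: "\<bar>up x\<bar> \<le> B" "\<bar>lo x\<bar> \<le> B" if "x \<in> D" for x
    using B[OF lift_ends_closure(1)[OF that]] B[OF lift_ends_closure(2)[OF that]]
      component_le_norm_cart[of "lift x (up x)" 3] component_le_norm_cart[of "lift x (lo x)" 3] by auto
  have flat: "slope up x + slope lo x = 0" if x: "x \<in> D" for x
  proof -
    have "- (up x + lo x) * curvature_gap x + - (slope up x + slope lo x) \<bullet> tilt_gap x = 0"
    proof (rule nonneg_weighted_divergence_eq_0[where B = "2 * B"])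
      fix y assume y: "y \<in> D"
      show "((\<lambda>x. - (up x + lo x)) has_derivative (\<lambda>v. - (slope up y + slope lo y) \<bullet> v)) (at y)"
        using has_derivative_minus[OF has_derivative_add[OF sheet_has_derivative[OF sheet_up y] sheet_has_derivative[OF sheet_lo y]]]
        by (simp add: inner_diff_left inner_minus_left)
      show "\<bar>- (up y + lo y)\<bar> \<le> 2 * B" using end_le[OF y] by linarith
      show "0 \<le> - (up y + lo y) * curvature_gap y + - (slope up y + slope lo y) \<bullet> tilt_gap y"
        using slope_sum_tilt_gap(1)[OF y] unfolding gap0[OF y] inner_minus_left by simp
    next
      show "continuous_on D (\<lambda>x. - (slope up x + slope lo x))"
        by (intro continuous_intros sheet_continuous_slope sheet_up sheet_lo)
    qed (rule x)
    then show ?thesis using slope_sum_tilt_gap(2)[OF x] unfolding gap0[OF x] inner_minus_left by simp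
  qed
  have "((\<lambda>x. up x + lo x) has_derivative (\<lambda>v. 0)) (at x within D)" if x: "x \<in> D" for x
  proof -
    have "((\<lambda>x. up x + lo x) has_derivative (\<lambda>v. (slope up x + slope lo x) \<bullet> v)) (at x)"
      using has_derivative_add[OF sheet_has_derivative[OF sheet_up x] sheet_has_derivative[OF sheet_lo x]]
      by (simp add: inner_add_left)
    then show ?thesis unfolding flat[OF x] by (simp add: has_derivative_at_withinI)
  qed
  from has_derivative_zero_constant[OF convex_shadow this]
  obtain c where "\<forall>x\<in>D. up x + lo x = c" by blast
  then show ?thesis by (intro exI[of _ "c / 2"]) simp
qed

text \<open>Only the assertion on the graph needs an argument: no boundary point strictly above the plane
  projects to the boundary of \<open>D\<close>. Indeed its mirror image is a different point of the closure on
  the same vertical line, so by strict convexity the midpoint lies in \<open>\<Omega>\<close>.\<close>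

lemma symmetric_of_midheight_constant:
  assumes l: "\<And>x. x \<in> D \<Longrightarrow> up x + lo x = 2 * l"
  shows "reflect3 l ` \<Omega> = \<Omega>"
    and "vertical_graph_over (frontier \<Omega> \<inter> {x. x $ 3 > l}) (\<Omega> \<inter> {x. x $ 3 = l})"
proof -
  have refl: "reflect3 l v = lift (horiz v) (2 * l - v $ 3)" for v
    by (simp add: reflect3_def vec_eq_iff forall_3 horiz_def)
  have refl_nth: "reflect3 l v $ 3 = 2 * l - v $ 3" "horiz (reflect3 l v) = horiz v" for v
    unfolding refl by simp_all
  have invol: "reflect3 l (reflect3 l v) = v" for v
    unfolding refl[of "reflect3 l v"] refl_nth by simp
  have sub: "reflect3 l v \<in> \<Omega>" if "v \<in> \<Omega>" for v
  proof -
    have hD: "horiz v \<in> D" using that unfolding shadow_def by auto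
    have "lo (horiz v) < v $ 3" "v $ 3 < up (horiz v)" using lift_mem_iff[OF hD, of "v $ 3"] that by auto
    then show ?thesis unfolding refl lift_mem_iff[OF hD] using l[OF hD] by linarith
  qed
  then show refl_\<Omega>: "reflect3 l ` \<Omega> = \<Omega>" using invol by (auto simp: image_iff) (metis invol sub)
  have cont: "continuous_on UNIV (reflect3 l)"
    unfolding refl[abs_def] by (intro continuous_intros)
  have refl_closure: "reflect3 l v \<in> closure \<Omega>" if "v \<in> closure \<Omega>" for v
  proof -
    have "reflect3 l ` closure \<Omega> \<subseteq> closure \<Omega>"
      using image_closure_subset[of \<Omega> "reflect3 l" "closure \<Omega>"] continuous_on_subset[OF cont]
        refl_\<Omega> closure_subset[of \<Omega>] by auto
    then show ?thesis using that by auto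
  qed
  have mid: "lo x < l \<and> l < up x" if "x \<in> D" for x using l[OF that] lo_less_up[OF that] by linarith
  show "vertical_graph_over (frontier \<Omega> \<inter> {x. x $ 3 > l}) (\<Omega> \<inter> {x. x $ 3 = l})"
    unfolding vertical_graph_over_def
  proof (intro exI set_eqI iffI)
    let ?h = "\<lambda>y. up (horiz y) - l"
    fix v
    {
      assume "v \<in> (\<lambda>x. x + ?h x *\<^sub>R axis 3 1) ` (\<Omega> \<inter> {x. x $ 3 = l})"
      then obtain y where y: "y \<in> \<Omega>" "y $ 3 = l" "v = y + ?h y *\<^sub>R axis 3 1" by auto
      have hD: "horiz y \<in> D" using y unfolding shadow_def by auto
      have "v = lift (horiz y) (up (horiz y))"
        using y(2,3) by (simp add: vec_eq_iff forall_3 horiz_def axis_def)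
      then show "v \<in> frontier \<Omega> \<inter> {x. x $ 3 > l}"
        using lift_frontier_iff[OF hD] mid[OF hD] by simp
    }
    assume v: "v \<in> frontier \<Omega> \<inter> {x. x $ 3 > l}"
    have hD: "horiz v \<in> D"
    proof -
      have "v \<in> closure \<Omega>" "reflect3 l v \<in> closure \<Omega>" using v refl_closure frontier_iff by auto
      moreover have "v \<noteq> reflect3 l v" using v refl_nth(1)[of v] by auto
      ultimately have "midpoint v (reflect3 l v) \<in> \<Omega>"
        using strictly_convex_\<Omega> open_\<Omega> unfolding strictly_convex_def
        by (metis interior_open midpoint_in_open_segment subset_eq)
      moreover have "horiz (midpoint v (reflect3 l v)) = horiz v"
        unfolding refl by (simp add: midpoint_def horiz_def)
      ultimately show ?thesis unfolding shadow_def by (metis imageI)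
    qed
    have "v $ 3 = up (horiz v)"
      using v lift_frontier_iff[OF hD, of "v $ 3"] mid[OF hD] by auto
    moreover have "lift (horiz v) l \<in> \<Omega>" using lift_mem_iff[OF hD] mid[OF hD] by simp
    moreover have "v = lift (horiz v) l + (v $ 3 - l) *\<^sub>R axis 3 1"
      by (simp add: vec_eq_iff forall_3 horiz_def axis_def)
    ultimately show "v \<in> (\<lambda>x. x + ?h x *\<^sub>R axis 3 1) ` (\<Omega> \<inter> {x. x $ 3 = l})"
      by (intro image_eqI[of _ _ "lift (horiz v) l"]) auto
  qed
qed

end

section \<open>Flows with constant vertical vorticity\<close>

locale vertical_vorticity_flow =
  fixes \<sigma> \<delta> \<alpha> :: real and \<Omega> :: "real \<Rightarrow> (real^3) set"
    and u :: "real \<Rightarrow> real^3 \<Rightarrow> real^3" and p :: "real \<Rightarrow> real^3 \<Rightarrow> real"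
  assumes solution: "classical_solution \<sigma> \<delta> \<Omega> u p" and \<alpha>_nonzero: "\<alpha> \<noteq> 0"
    and vorticity: "\<And>t x. t \<in> {-\<delta><..<\<delta>} \<Longrightarrow> x \<in> \<Omega> t \<Longrightarrow> curl (u t) x = \<alpha> *\<^sub>R axis 3 1"
begin

abbreviation "S \<equiv> space_time \<delta> \<Omega>"

lemma open_S: "open S"
  using solution unfolding classical_solution_def moving_domain_def by simp

lemma mem_S_iff: "(t, x) \<in> S \<longleftrightarrow> t \<in> {-\<delta><..<\<delta>} \<and> x \<in> \<Omega> t"
  unfolding space_time_def by simp

lemma open_slice: assumes "t \<in> {-\<delta><..<\<delta>}" shows "open (\<Omega> t)"
  using solution assms unfolding classical_solution_def by blast

lemma eventually_S:
  assumes "(t, x) \<in> S" shows "\<forall>\<^sub>F s in nhds t. (s, x) \<in> S"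
proof -
  have "((\<lambda>s. (s, x)) \<longlongrightarrow> (t, x)) (nhds t)"
    by (intro tendsto_intros) (auto intro: filterlim_ident)
  then show ?thesis using open_S assms by (rule topological_tendstoD)
qed

lemma u_has_derivatives:
  assumes "(t, x) \<in> S"
  shows "(u t has_derivative frechet_derivative (u t) (at x)) (at x)"
    and "((\<lambda>s. u s x) has_vector_derivative vector_derivative (\<lambda>s. u s x) (at t)) (at t)"
proof -
  have "(\<lambda>(t, x). u t x) differentiable_on S"
    using solution unfolding classical_solution_def by blast
  then have "(\<lambda>(t, x). u t x) differentiable at (t, x)"
    using assms open_S differentiable_on_eq_differentiable_at by blast
  then obtain L where L: "((\<lambda>(t, x). u t x) has_derivative L) (at (t, x))"
    unfolding differentiable_def by blast
  have "((\<lambda>y. (t, y)) has_derivative (\<lambda>v. (0, v))) (at x)"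
    by (intro derivative_eq_intros) auto
  from diff_chain_at[OF this L] have "u t differentiable at x"
    unfolding differentiable_def by (auto simp: o_def)
  then show "(u t has_derivative frechet_derivative (u t) (at x)) (at x)"
    by (simp add: frechet_derivative_works)
  have "((\<lambda>s. (s, x)) has_derivative (\<lambda>h. (h, 0))) (at t)"
    by (intro derivative_eq_intros) auto
  from diff_chain_at[OF this L] have "(\<lambda>s. u s x) differentiable at t"
    unfolding differentiable_def by (auto simp: o_def)
  then show "((\<lambda>s. u s x) has_vector_derivative vector_derivative (\<lambda>s. u s x) (at t)) (at t)"
    by (simp add: vector_derivative_works)
qed

lemma linear_frechet_u:
  assumes "(t, x) \<in> S" shows "linear (frechet_derivative (u t) (at x))"
  using u_has_derivatives(1)[OF assms] by (rule has_derivative_linear)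

lemma frechet_u_eq:
  assumes "(t, x) \<in> S"
  shows "frechet_derivative (u t) (at x) v = (\<Sum>j\<in>UNIV. v $ j *\<^sub>R partial_deriv j (u t) x)"
  using linear_eq_sum_Basis[OF linear_frechet_u[OF assms], of v]
  unfolding sum_Basis_3 sum_3 partial_deriv_def by (simp add: inner_axis)

text \<open>As the vorticity is constant in space and time, the left-hand side of the vorticity equation
  vanishes, and \<open>\<alpha> \<partial>\<^sub>3 u\<close> is all that remains on the right.\<close>

lemma partial_deriv_3_u:
  assumes tx: "(t, x) \<in> S" shows "partial_deriv 3 (u t) x = 0"
proof -
  have t: "t \<in> {-\<delta><..<\<delta>}" and x: "x \<in> \<Omega> t" using tx mem_S_iff by auto
  let ?c = "\<alpha> *\<^sub>R axis 3 1 :: real^3"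
  have "(curl (u t) has_derivative (\<lambda>v. 0)) (at x)"
    using has_derivative_transform_within_open[OF has_derivative_const[of ?c] open_slice[OF t] x, of "curl (u t)"]
      vorticity[OF t] by simp
  then have "frechet_derivative (curl (u t)) (at x) = (\<lambda>v. 0)"
    by (rule frechet_derivative_at[symmetric])
  then have adv: "advect (u t) (curl (u t)) x = 0"
    unfolding advect_def partial_deriv_def by simp
  have "\<forall>\<^sub>F s in nhds t. curl (u s) x = ?c"
    using eventually_S[OF tx] by eventually_elim (use vorticity mem_S_iff in blast)
  then obtain A where A: "open A" "t \<in> A" "\<And>s. s \<in> A \<Longrightarrow> curl (u s) x = ?c"
    unfolding eventually_nhds by blast
  have "((\<lambda>s. curl (u s) x) has_vector_derivative 0) (at t)"
    using has_vector_derivative_transform_within_open[OF has_vector_derivative_const[of ?c] A(1,2), of "\<lambda>s. curl (u s) x"]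
      A(3) by simp
  then have time: "vector_derivative (\<lambda>s. curl (u s) x) (at t) = 0"
    by (rule vector_derivative_at)
  have "vector_derivative (\<lambda>s. curl (u s) x) (at t) + advect (u t) (curl (u t)) x
             = advect (curl (u t)) (u t) x"
    using solution t x unfolding classical_solution_def by blast
  then have "advect (curl (u t)) (u t) x = 0" unfolding adv time by simp
  then show ?thesis unfolding advect_def vorticity[OF t x]
    using \<alpha>_nonzero by (simp add: sum_3 axis_def)
qed

lemma partial_deriv_u_3:
  assumes tx: "(t, x) \<in> S" shows "partial_deriv j (u t) x $ 3 = 0"
proof -
  have "curl (u t) x = \<alpha> *\<^sub>R axis 3 1" using tx vorticity mem_S_iff by blast
  then have "curl (u t) x $ 1 = 0" "curl (u t) x $ 2 = 0" by (simp_all add: axis_def)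
  then have "partial_deriv 2 (u t) x $ 3 = 0" "partial_deriv 1 (u t) x $ 3 = 0"
    unfolding curl_def using partial_deriv_3_u[OF tx] by simp_all
  then have "\<forall>j. partial_deriv j (u t) x $ 3 = 0"
    unfolding forall_3 using partial_deriv_3_u[OF tx] by simp
  then show ?thesis by blast
qed

lemma u_3_has_derivative_0:
  assumes tx: "(t, x) \<in> S" shows "((\<lambda>y. u t y $ 3) has_derivative (\<lambda>v. 0)) (at x)"
proof -
  have "((\<lambda>y. u t y $ 3) has_derivative (\<lambda>v. frechet_derivative (u t) (at x) v $ 3)) (at x)"
    by (rule bounded_linear.has_derivative[OF bounded_linear_vec_nth u_has_derivatives(1)[OF tx]])
  moreover have "frechet_derivative (u t) (at x) v $ 3 = 0" for v
    unfolding frechet_u_eq[OF tx] using partial_deriv_u_3[OF tx] by simp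
  ultimately show ?thesis by simp
qed

lemma u_3_eq_on_segment:
  assumes "\<And>z. z \<in> closed_segment x y \<Longrightarrow> (t, z) \<in> S"
  shows "u t x $ 3 = u t y $ 3"
proof -
  have "\<exists>c. \<forall>z\<in>closed_segment x y. u t z $ 3 = c"
    by (rule has_derivative_zero_constant)
      (auto intro: has_derivative_at_withinI u_3_has_derivative_0 assms)
  then show ?thesis by fastforce
qed

lemma u_eq_on_vertical_segment:
  assumes seg: "\<And>z. z \<in> closed_segment x y \<Longrightarrow> (t, z) \<in> S" and "x $ 1 = y $ 1" "x $ 2 = y $ 2"
  shows "u t x = u t y"
proof -
  let ?g = "\<lambda>s::real. u t (x + s *\<^sub>R (y - x))"
  have "\<exists>c. \<forall>s\<in>{0..1}. ?g s = c"
  proof (rule has_derivative_zero_constant)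
    fix s :: real assume s: "s \<in> {0..1}"
    have "x + s *\<^sub>R (y - x) = (1 - s) *\<^sub>R x + s *\<^sub>R y" by (simp add: algebra_simps)
    then have "x + s *\<^sub>R (y - x) \<in> closed_segment x y" using s unfolding in_segment by auto
    then have S: "(t, x + s *\<^sub>R (y - x)) \<in> S" by (rule seg)
    have "((\<lambda>s::real. x + s *\<^sub>R (y - x)) has_derivative (\<lambda>h. h *\<^sub>R (y - x))) (at s)"
      by (auto intro!: derivative_eq_intros)
    from diff_chain_at[OF this u_has_derivatives(1)[OF S]]
    have "(?g has_derivative (\<lambda>h. frechet_derivative (u t) (at (x + s *\<^sub>R (y - x))) (h *\<^sub>R (y - x)))) (at s)"
      by (simp add: o_def)
    moreover have "frechet_derivative (u t) (at (x + s *\<^sub>R (y - x))) (h *\<^sub>R (y - x)) = 0" for h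
      unfolding frechet_u_eq[OF S] sum_3 using partial_deriv_3_u[OF S] assms(2,3) by simp
    ultimately show "(?g has_derivative (\<lambda>h. 0)) (at s within {0..1})"
      by (simp add: has_derivative_at_withinI)
  qed simp
  then obtain c where "\<And>s. 0 \<le> s \<Longrightarrow> s \<le> 1 \<Longrightarrow> ?g s = c" by auto
  from this[of 0] this[of 1] show ?thesis by simp
qed

text \<open>The segment is compact and the space-time domain is open, so the segment stays in the fluid for a
  short time. During that time \<open>u\<^sub>3\<close> takes the same value at both ends.\<close>

lemma time_derivative_u_3_eq_on_segment:
  assumes seg: "\<And>z. z \<in> closed_segment x y \<Longrightarrow> (t, z) \<in> S"
  shows "vector_derivative (\<lambda>s. u s x) (at t) $ 3 = vector_derivative (\<lambda>s. u s y) (at t) $ 3"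
proof -
  let ?V = "\<lambda>x. vector_derivative (\<lambda>s. u s x) (at t)"
  have d: "((\<lambda>s. u s z $ 3) has_vector_derivative ?V z $ 3) (at t)" if "(t, z) \<in> S" for z
    by (rule bounded_linear.has_vector_derivative[OF bounded_linear_vec_nth u_has_derivatives(2)[OF that]])
  have "compact ({t} \<times> closed_segment x y)" by (intro compact_Times) auto
  moreover have "{t} \<times> closed_segment x y \<subseteq> S" using seg by auto
  ultimately obtain e where e: "e > 0" "(\<Union>q\<in>{t} \<times> closed_segment x y. ball q e) \<subseteq> S"
    using compact_subset_open_imp_ball_epsilon_subset[OF _ open_S] by metis
  have "u s x $ 3 = u s y $ 3" if "s \<in> ball t e" for s
  proof (rule u_3_eq_on_segment)
    fix z assume "z \<in> closed_segment x y"
    moreover have "(s, z) \<in> ball (t, z) e" using that by (simp add: dist_Pair_Pair)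
    ultimately show "(s, z) \<in> S" using e(2) by blast
  qed
  then have "((\<lambda>s. u s x $ 3) has_vector_derivative ?V y $ 3) (at t)"
    using e(1) by (intro has_vector_derivative_transform_within_open[OF d[OF seg] open_ball, of y t e]) auto
  then show ?thesis using d[OF seg, of x] vector_derivative_unique_at by auto
qed

lemma grad_p_3:
  assumes tx: "(t, x) \<in> S"
  shows "grad (p t) x $ 3 = - (vector_derivative (\<lambda>s. u s x) (at t) $ 3)"
proof -
  have "vector_derivative (\<lambda>s. u s x) (at t) + advect (u t) (u t) x + grad (p t) x = 0"
    using solution tx unfolding mem_S_iff classical_solution_def by blast
  then have "(vector_derivative (\<lambda>s. u s x) (at t) + advect (u t) (u t) x + grad (p t) x) $ 3 = 0" by simp
  moreover have "advect (u t) (u t) x $ 3 = 0"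
    unfolding advect_def using partial_deriv_u_3[OF tx] by simp
  ultimately show ?thesis by simp
qed

text \<open>By the vertical momentum equation, \<open>\<partial>\<^sub>3 p\<close> is a constant \<open>\<kappa>\<close> on the convex set \<open>\<Omega> t\<close>. Hence
  \<open>p - \<kappa> x\<^sub>3\<close> is constant along vertical chords up to their ends, where \<open>p\<close> is \<open>\<sigma>\<close> times the mean
  curvature.\<close>

lemma curvature_gap_proportional:
  assumes t: "t \<in> {-\<delta><..<\<delta>}" and \<sigma>: "\<sigma> \<noteq> 0" and body: "strictly_convex_body (\<Omega> t)"
  shows "\<exists>\<mu>. \<forall>x\<in>shadow (\<Omega> t).
    strictly_convex_body.curvature_gap (\<Omega> t) x = \<mu> * (upper (\<Omega> t) x - lower (\<Omega> t) x)"
proof -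
  interpret strictly_convex_body "\<Omega> t" by (rule body)
  let ?V = "\<lambda>x. vector_derivative (\<lambda>s. u s x) (at t) $ 3"
  obtain \<kappa> where \<kappa>: "\<And>x. x \<in> \<Omega> t \<Longrightarrow> grad (p t) x $ 3 = \<kappa>"
  proof (cases "\<Omega> t = {}")
    case False
    then obtain y where y: "y \<in> \<Omega> t" by blast
    have "grad (p t) x $ 3 = - ?V y" if x: "x \<in> \<Omega> t" for x
    proof -
      have "closed_segment x y \<subseteq> \<Omega> t" using convex_\<Omega> x y by (rule closed_segment_subset[rotated 2])
      then have "?V x = ?V y" using t by (intro time_derivative_u_3_eq_on_segment) (auto simp: mem_S_iff)
      then show ?thesis using grad_p_3 x t by (simp add: mem_S_iff)
    qed
    then show thesis by (rule that)
  qed (use that in blast)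
  have sol: "continuous_on (closure (\<Omega> t)) (p t)" "p t differentiable_on \<Omega> t"
    "\<And>x. x \<in> frontier (\<Omega> t) \<Longrightarrow> p t x = \<sigma> * mean_curvature (\<Omega> t) x"
    using solution t unfolding classical_solution_def by auto
  have "curvature_gap x = \<kappa> / \<sigma> * (up x - lo x)" if x: "x \<in> D" for x
  proof -
    let ?f = "\<lambda>z. p t (lift x z) - \<kappa> * z"
    have "?f (up x) = ?f (lo x)"
    proof (rule DERIV_isconst_end[OF lo_less_up[OF x]])
      have "lift x z \<in> closure (\<Omega> t)" if "z \<in> {lo x..up x}" for z
        using that lift_closure_iff[OF x, of z] by simp
      then have "lift x ` {lo x..up x} \<subseteq> closure (\<Omega> t)" by blast
      moreover have "continuous_on {lo x..up x} (lift x)" by (intro continuous_intros)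
      ultimately have "continuous_on {lo x..up x} (\<lambda>z. p t (lift x z))"
        by (intro continuous_on_compose2[OF sol(1)])
      then show "continuous_on {lo x..up x} ?f" by (intro continuous_intros)
      fix z assume z: "lo x < z" "z < up x"
      then have mem: "lift x z \<in> \<Omega> t" using lift_mem_iff[OF x] by simp
      then have "p t differentiable at (lift x z)"
        using sol(2) open_\<Omega> differentiable_on_eq_differentiable_at by blast
      then have grad: "(p t has_derivative (\<lambda>v. grad (p t) (lift x z) \<bullet> v)) (at (lift x z))"
        by (rule has_derivative_grad)
      have "((\<lambda>z. lift x z) has_derivative (\<lambda>h. lift 0 h)) (at z)"
        by (rule has_derivative_lift) (auto intro: derivative_eq_intros)
      from diff_chain_at[OF this grad]
      have "((\<lambda>z. p t (lift x z)) has_derivative (\<lambda>h. grad (p t) (lift x z) \<bullet> lift 0 h)) (at z)"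
        by (simp add: o_def)
      moreover have "(\<lambda>h. grad (p t) (lift x z) \<bullet> lift 0 h) = (*) \<kappa>"
        using \<kappa>[OF mem] by (auto simp: inner_lift)
      ultimately have "DERIV (\<lambda>z. p t (lift x z)) z :> \<kappa>" unfolding has_field_derivative_def by simp
      then show "DERIV ?f z :> 0" by (auto intro!: derivative_eq_intros)
    qed
    moreover have "lift x (up x) \<in> frontier (\<Omega> t)" "lift x (lo x) \<in> frontier (\<Omega> t)"
      using lift_frontier_iff[OF x] by auto
    ultimately have "\<sigma> * curvature_gap x = \<kappa> * (up x - lo x)"
      unfolding curvature_gap_def using sol(3) by (simp add: algebra_simps)
    then show ?thesis using \<sigma> by (simp add: field_simps)
  qed
  then show ?thesis by blast
qed

end

lemma vec_nth_const_zero_of_integral_zero: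
  fixes f :: "real^'n \<Rightarrow> real^'m"
  assumes \<Omega>: "open \<Omega>" "bounded \<Omega>" and f: "square_integrable_on f \<Omega>"
    and int: "(LINT x|lebesgue_on \<Omega>. f x) = 0"
    and c: "\<And>x. x \<in> \<Omega> \<Longrightarrow> f x $ i = c" and ne: "\<Omega> \<noteq> {}"
  shows "c = 0"
proof -
  have L: "\<Omega> \<in> lmeasurable" using \<Omega> lmeasurable_open by blast
  interpret finite_measure "lebesgue_on \<Omega>" using L by (rule finite_measure_lebesgue_on)
  have "integrable (lebesgue_on \<Omega>) (\<lambda>x. 1 + (norm (f x))\<^sup>2)"
    using f unfolding square_integrable_on_def by (intro Bochner_Integration.integrable_add integrable_const) auto
  then have "integrable (lebesgue_on \<Omega>) f"
  proof (rule Bochner_Integration.integrable_bound)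
    show "f \<in> borel_measurable (lebesgue_on \<Omega>)" using f unfolding square_integrable_on_def by blast
    have "norm (f x) \<le> norm (1 + (norm (f x))\<^sup>2)" for x
    proof -
      have "0 \<le> (norm (f x) - 1 / 2)\<^sup>2" by simp
      then have "norm (f x) \<le> 1 + (norm (f x))\<^sup>2" by (simp add: power2_eq_square algebra_simps)
      then show ?thesis by simp
    qed
    then show "AE x in lebesgue_on \<Omega>. norm (f x) \<le> norm (1 + (norm (f x))\<^sup>2)" by simp
  qed
  from integral_bounded_linear[OF bounded_linear_vec_nth this, of i]
  have "(LINT x|lebesgue_on \<Omega>. f x $ i) = 0" unfolding int by simp
  moreover have "(LINT x|lebesgue_on \<Omega>. f x $ i) = (LINT x|lebesgue_on \<Omega>. c)"
    using c by (intro Bochner_Integration.integral_cong) (auto simp: space_restrict_space)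
  moreover have "(LINT x|lebesgue_on \<Omega>. c) = measure lebesgue \<Omega> * c"
    using L by (simp add: measure_restrict_space space_restrict_space)
  moreover have "measure lebesgue \<Omega> \<noteq> 0"
    using \<Omega>(1) ne L open_not_negligible negligible_iff_measure by blast
  ultimately show ?thesis by (metis mult_eq_0_iff)
qed

theorem theorem1p1:
  fixes \<sigma>0 \<alpha>0 \<delta> :: real
    and \<Omega>0 :: "(real^3) set" and u0 :: "real^3 \<Rightarrow> real^3"
    and \<Omega> :: "real \<Rightarrow> (real^3) set" and u :: "real \<Rightarrow> real^3 \<Rightarrow> real^3"
    and p :: "real \<Rightarrow> real^3 \<Rightarrow> real"
  assumes "\<sigma>0 > 0" and "\<alpha>0 \<noteq> 0"
    and "open \<Omega>0" and "bounded \<Omega>0" and "strictly_convex \<Omega>0" and "Ck_boundary 5 \<Omega>0"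
    and "u0 \<in> sobolev_H 5 \<Omega>0"
    and "\<forall>x\<in>\<Omega>0. curl u0 x = \<alpha>0 *\<^sub>R axis 3 1"
    and "(LINT x|lebesgue_on \<Omega>0. u0 x) = 0"
    and "\<delta> > 0"
    and "classical_solution \<sigma>0 \<delta> \<Omega> u p"
    and "\<Omega> 0 = \<Omega>0" and "\<forall>x\<in>\<Omega>0. u 0 x = u0 x"
    and "\<forall>t\<in>{-\<delta><..<\<delta>}. \<forall>x\<in>\<Omega> t. curl (u t) x = \<alpha>0 *\<^sub>R axis 3 1"
  shows "\<exists>l0.
    reflect3 l0 ` \<Omega>0 = \<Omega>0 \<and>
    vertical_graph_over (frontier \<Omega>0 \<inter> {x. x $ 3 > l0}) (\<Omega>0 \<inter> {x. x $ 3 = l0}) \<and>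
    (\<forall>x\<in>\<Omega>0. \<forall>y\<in>\<Omega>0. x $ 1 = y $ 1 \<and> x $ 2 = y $ 2 \<longrightarrow> u0 x = u0 y) \<and>
    (\<forall>x\<in>\<Omega>0. u0 x $ 3 = 0)"
proof -
  have body: "strictly_convex_body \<Omega>0"
    using assms(3-6) Ck_boundary_antimono[of 5 \<Omega>0 2] by unfold_locales auto
  interpret strictly_convex_body \<Omega>0 by (rule body)
  interpret flow: vertical_vorticity_flow \<sigma>0 \<delta> \<alpha>0 \<Omega> u p
    using assms(2,11,14) by unfold_locales auto
  have 0: "0 \<in> {-\<delta><..<\<delta>}" using \<open>\<delta> > 0\<close> by simp
  have seg: "(0, z) \<in> flow.S" if "x \<in> \<Omega>0" "y \<in> \<Omega>0" "z \<in> closed_segment x y" for x y z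
    using closed_segment_subset[OF that(1,2) convex_\<Omega>] that(3) 0
    unfolding flow.mem_S_iff \<open>\<Omega> 0 = \<Omega>0\<close> by blast
  obtain \<mu> where "\<And>x. x \<in> D \<Longrightarrow> curvature_gap x = \<mu> * (up x - lo x)"
    using flow.curvature_gap_proportional[OF 0] body assms(1) unfolding \<open>\<Omega> 0 = \<Omega>0\<close> by auto
  note gap = this
  have "(\<forall>x\<in>D. 0 \<le> curvature_gap x) \<or> (\<forall>x\<in>D. curvature_gap x \<le> 0)"
  proof (cases "0 \<le> \<mu>")
    case True
    then show ?thesis using lo_less_up by (simp add: gap less_imp_le)
  next
    case False
    then show ?thesis using lo_less_up by (simp add: gap less_imp_le mult_nonpos_nonneg)
  qed
  then obtain l where l: "\<And>x. x \<in> D \<Longrightarrow> up x + lo x = 2 * l"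
    using midheight_constant by blast
  have "u0 x = u0 y" if "x \<in> \<Omega>0" "y \<in> \<Omega>0" "x $ 1 = y $ 1 \<and> x $ 2 = y $ 2" for x y
    using flow.u_eq_on_vertical_segment[of x y 0] seg[OF that(1,2)] that assms(13) by auto
  moreover have "u0 x $ 3 = 0" if x: "x \<in> \<Omega>0" for x
  proof (rule vec_nth_const_zero_of_integral_zero[OF assms(3,4) _ assms(9)])
    show "square_integrable_on u0 \<Omega>0" using assms(7) unfolding sobolev_H_def by blast
    show "u0 y $ 3 = u0 x $ 3" if "y \<in> \<Omega>0" for y
      using flow.u_3_eq_on_segment[of y x 0] seg[OF that x] that x assms(13) by auto
    show "\<Omega>0 \<noteq> {}" using x by blast
  qed
  ultimately show ?thesis using symmetric_of_midheight_constant[OF l] by blast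
qed

end
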